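(* Let $n\ge 7$. If $G$ and $H$ are graphs on $n$ vertices with the same $(n-3)$-deck, i.e. $\mathcal{D}_{n-3}(G)=\mathcal{D}_{n-3}(H)$, then $G$ is connected if and only if $H$ is connected. (Thus connectedness is $3$-reconstructible for $n$-vertex graphs when $n\ge7$.) Moreover, the threshold on $n$ is sharp: there exist two graphs on $6$ vertices with the same $3$-deck such that one is connected and the other is not.
   Context: All graphs are finite and simple. For a graph $G$, a $k$-card of $G$ is an induced subgraph of $G$ on $k$ vertices, considered up to isomorphism. The $k$-deck $\mathcal{D}_k(G)$ is the multiset of all $k$-cards of $G$ (one for each $k$-element vertex subset). A graph invariant or property is called $l$-reconstructible (for $n$-vertex graphs) if it is determined by the $(n-l)$-deck, i.e. any two $n$-vertex graphs with the same $(n-l)$-deck agree on it. *)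

theory Defs
  imports Main "HOL-Library.Multiset"
begin

definition simple_graph :: "'a set \<Rightarrow> 'a set set \<Rightarrow> bool" where
  "simple_graph V E \<longleftrightarrow> finite V \<and> (\<forall>e\<in>E. e \<subseteq> V \<and> card e = 2)"

text \<open>Isomorphism class of the induced subgraph G[S], represented canonically as the
set of all edge sets on vertex set {0..<card S} isomorphic to G[S].\<close>
definition card_class :: "'a set set \<Rightarrow> 'a set \<Rightarrow> nat set set set" where
  "card_class E S = {F. \<exists>f. bij_betw f S {0..<card S} \<and> F = (\<lambda>e. f ` e) ` {e\<in>E. e \<subseteq> S}}"

definition deck :: "nat \<Rightarrow> 'a set \<Rightarrow> 'a set set \<Rightarrow> nat set set set multiset" where
  "deck k V E = image_mset (card_class E) (mset_set {S. S \<subseteq> V \<and> card S = k})"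

definition connected_graph :: "'a set \<Rightarrow> 'a set set \<Rightarrow> bool" where
  "connected_graph V E \<longleftrightarrow> V \<noteq> {} \<and>
     (\<forall>u\<in>V. \<forall>v\<in>V. (\<lambda>x y. {x, y} \<in> E)\<^sup>*\<^sup>* u v)"

end

theory Submission
  imports Defs "HOL-Library.FuncSet"
begin

text \<open>
  Let \<open>G\<close> be connected and \<open>H\<close> disconnected with the same \<open>(n - 3)\<close>-deck. By Kelly's lemma the deck determines,
  for cliques \<open>X\<close> of size \<open>f\<close> with \<open>r(X)\<close> outside neighbours, every sum of \<open>p(r(X))\<close> over all \<open>X\<close> where \<open>p\<close> is a
  polynomial of degree at most \<open>n - 3 - f\<close>; it also determines the number \<open>c\<close> of connected cards. Since \<open>c\<close> is at
  least 2 in \<open>G\<close>, the graph \<open>H\<close> has an isolated vertex, or an isolated edge with \<open>c \<le> n - 2\<close>.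

  An isolated vertex is excluded by evaluating a suitable \<open>p\<close> on the degrees if \<open>n \<ge> 9\<close>; the cases \<open>n = 8\<close> and
  \<open>n = 7\<close> use integrality of the degree counts, and for \<open>n = 7\<close> also the numbers of \<open>K\<^sub>4\<close> and of induced \<open>2K\<^sub>2\<close>.

  If \<open>H\<close> has an isolated edge, a polynomial statistic of the edges shows that \<open>G\<close> has many edges with \<open>r = 1\<close> or
  many edges with \<open>r = 4\<close> or \<open>r = 5\<close>. In a connected graph either of these forces more than \<open>n - 2\<close> connected
  cards: \<open>k\<close> edges with \<open>r = 1\<close> give \<open>k (k - 1)\<close> of them, and an edge with \<open>r \<ge> 4\<close> lies in at least 8 (in at least 6
  for \<open>n = 7\<close>). For large \<open>n\<close> it suffices that there are at most \<open>3 n\<close> edges with \<open>r \<le> 5\<close>.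

  For six vertices, the path and the disjoint union of a 4-cycle and an edge have the same 3-deck.
\<close>

section \<open>Statistics determined by the deck\<close>

definition ksets :: "'a set \<Rightarrow> nat \<Rightarrow> 'a set set" where
  "ksets V k = {S. S \<subseteq> V \<and> card S = k}"

lemma finite_ksets: "finite V \<Longrightarrow> finite (ksets V k)"
  by (simp add: ksets_def)

definition iso_between :: "('a \<Rightarrow> 'b) \<Rightarrow> 'a set set \<Rightarrow> 'a set \<Rightarrow> 'b set set \<Rightarrow> 'b set \<Rightarrow> bool" where
  "iso_between g E S F T \<longleftrightarrow> bij_betw g S T \<and> (\<forall>x\<in>S. \<forall>y\<in>S. {x, y} \<in> E \<longleftrightarrow> {g x, g y} \<in> F)"

lemma iso_between_restrict:
  assumes "iso_between g E S F T" "X \<subseteq> S"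
  shows "iso_between g E X F (g ` X)"
  using assms unfolding iso_between_def
  by (meson bij_betw_subset subsetD)

lemma card_class_member_iff:
  assumes "bij_betw f S {0..<card S}" "x \<in> S" "y \<in> S"
  shows "{x, y} \<in> E \<longleftrightarrow> {f x, f y} \<in> (\<lambda>e. f ` e) ` {e \<in> E. e \<subseteq> S}"
proof
  assume "{x, y} \<in> E"
  then show "{f x, f y} \<in> (\<lambda>e. f ` e) ` {e \<in> E. e \<subseteq> S}"
    using assms by (intro image_eqI[where x = "{x, y}"]) auto
next
  assume "{f x, f y} \<in> (\<lambda>e. f ` e) ` {e \<in> E. e \<subseteq> S}"
  then obtain e where e: "e \<in> E" "e \<subseteq> S" "f ` {x, y} = f ` e" by auto
  have "inj_on f S" using assms(1) by (simp add: bij_betw_def)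
  then have "{x, y} = e" using e assms by (metis empty_subsetI inj_on_image_eq_iff insert_subset)
  then show "{x, y} \<in> E" using e by simp
qed

text \<open>The two classes share a concrete edge set \<open>P\<close>, reached by a bijection
  \<open>f\<close> from \<open>S\<close> and by a bijection \<open>h\<close> from \<open>T\<close>.
  Going along \<open>f\<close> and back along \<open>h\<close> preserves adjacency, since both
  compare it with membership in \<open>P\<close>.\<close>

lemma card_class_eq_imp_iso:
  assumes eq: "card_class E S = card_class F T" and fin: "finite S" "finite T" and c: "card S = card T"
  shows "\<exists>g. iso_between g E S F T"
proof -
  obtain f where f: "bij_betw f S {0..<card S}" using ex_bij_betw_finite_nat[OF fin(1)] by blast
  define P where "P = (\<lambda>e. f ` e) ` {e \<in> E. e \<subseteq> S}"
  have "P \<in> card_class E S" unfolding card_class_def P_def using f by blast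
  then have "P \<in> card_class F T" using eq by simp
  then obtain h where h: "bij_betw h T {0..<card T}" "P = (\<lambda>e. h ` e) ` {e \<in> F. e \<subseteq> T}"
    unfolding card_class_def by blast
  define g where "g = inv_into T h \<circ> f"
  have bg: "bij_betw g S T" unfolding g_def
    using bij_betw_trans[OF f] bij_betw_inv_into[OF h(1)] c by metis
  have hg: "h (g x) = f x" if "x \<in> S" for x
    unfolding g_def comp_def
    using that f h(1) c by (metis bij_betwE bij_betw_inv_into_right)
  have "{x, y} \<in> E \<longleftrightarrow> {g x, g y} \<in> F" if "x \<in> S" "y \<in> S" for x y
  proof -
    have "g x \<in> T" "g y \<in> T" using bg that by (auto simp: bij_betw_def)
    then have "{g x, g y} \<in> F \<longleftrightarrow> {f x, f y} \<in> P"
      using card_class_member_iff[OF h(1), of "g x" "g y" F] h(2) hg that by simp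
    moreover have "{x, y} \<in> E \<longleftrightarrow> {f x, f y} \<in> P"
      using card_class_member_iff[OF f that] unfolding P_def by blast
    ultimately show ?thesis by simp
  qed
  then show ?thesis using bg unfolding iso_between_def by blast
qed

text \<open>\<open>p\<close> and \<open>q\<close> factor through \<open>f\<close> and
  \<open>g\<close> by one common function \<open>r\<close>, which can then be applied to the common
  image multiset. It serves twice: to pass from equal decks to equal invariants, and at the end to
  pass from edge numbers of triples to equal decks.\<close>

lemma image_mset_eq_transfer:
  assumes "image_mset f M = image_mset g N"
    and "\<And>x y. x \<in># M \<Longrightarrow> y \<in># N \<Longrightarrow> f x = g y \<Longrightarrow> p x = q y"
  shows "image_mset p M = image_mset q N"
proof -
  define r where "r c = p (SOME x. x \<in># M \<and> f x = c)" for c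
  have ex: "\<exists>x. x \<in># M \<and> f x = g y" if "y \<in># N" for y
  proof -
    have "g y \<in># image_mset f M" using that assms(1) by simp
    then show ?thesis by auto
  qed
  have q: "q y = r (g y)" if "y \<in># N" for y
  proof -
    have "(SOME x. x \<in># M \<and> f x = g y) \<in># M \<and> f (SOME x. x \<in># M \<and> f x = g y) = g y"
      using ex[OF that] by (rule someI_ex)
    then show ?thesis unfolding r_def using assms(2) that by metis
  qed
  have p: "p x = r (f x)" if x: "x \<in># M" for x
  proof -
    have "f x \<in># image_mset g N" using x assms(1)[symmetric] by simp
    then obtain y where "y \<in># N" "g y = f x" by auto
    then show ?thesis using q assms(2)[OF x] by metis
  qed
  have "image_mset p M = image_mset r (image_mset f M)"
    using p by (auto simp: multiset.map_comp intro!: image_mset_cong)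
  also have "\<dots> = image_mset r (image_mset g N)" using assms(1) by simp
  also have "\<dots> = image_mset q N"
    using q by (auto simp: multiset.map_comp intro!: image_mset_cong)
  finally show ?thesis .
qed

lemma deck_sum_eq:
  assumes fin: "finite V" "finite W" and deck: "deck k V E = deck k W F"
    and inv: "\<And>S T g. S \<in> ksets V k \<Longrightarrow> T \<in> ksets W k \<Longrightarrow> iso_between g E S F T \<Longrightarrow> p S = q T"
  shows "(\<Sum>S\<in>ksets V k. p S) = (\<Sum>T\<in>ksets W k. q T)"
proof -
  have "image_mset p (mset_set (ksets V k)) = image_mset q (mset_set (ksets W k))"
  proof (rule image_mset_eq_transfer)
    show "image_mset (card_class E) (mset_set (ksets V k)) = image_mset (card_class F) (mset_set (ksets W k))"
      using deck by (simp add: deck_def ksets_def)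
    fix S T assume ST: "S \<in># mset_set (ksets V k)" "T \<in># mset_set (ksets W k)"
      and c: "card_class E S = card_class F T"
    then have S: "S \<in> ksets V k" and T: "T \<in> ksets W k" using fin by (simp_all add: finite_ksets)
    moreover have "finite S" "finite T" using S T fin by (auto simp: ksets_def intro: finite_subset)
    ultimately have "\<exists>g. iso_between g E S F T"
      using card_class_eq_imp_iso[OF c] unfolding ksets_def by simp
    then show "p S = q T" using inv S T by blast
  qed
  then show ?thesis by (simp add: sum_unfold_sum_mset)
qed

lemma card_supersets:
  assumes "finite V" "T \<subseteq> V" "card T \<le> k"
  shows "card {S \<in> ksets V k. T \<subseteq> S} = (card V - card T) choose (k - card T)"
proof -
  have fT: "finite T" using assms finite_subset by blast
  have "bij_betw (\<lambda>A. A \<union> T) {A. A \<subseteq> V - T \<and> card A = k - card T} {S \<in> ksets V k. T \<subseteq> S}"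
  proof (rule bij_betwI[where g = "\<lambda>S. S - T"])
    show "(\<lambda>A. A \<union> T) \<in> {A. A \<subseteq> V - T \<and> card A = k - card T} \<rightarrow> {S \<in> ksets V k. T \<subseteq> S}"
    proof
      fix A assume A: "A \<in> {A. A \<subseteq> V - T \<and> card A = k - card T}"
      then have "finite A" using assms finite_subset by blast
      then have "card (A \<union> T) = card A + card T" using A fT by (intro card_Un_disjoint) auto
      then show "A \<union> T \<in> {S \<in> ksets V k. T \<subseteq> S}" using A assms by (auto simp: ksets_def)
    qed
    show "(\<lambda>S. S - T) \<in> {S \<in> ksets V k. T \<subseteq> S} \<rightarrow> {A. A \<subseteq> V - T \<and> card A = k - card T}"
      using fT by (auto simp: ksets_def card_Diff_subset)
  qed auto
  then have "card {S \<in> ksets V k. T \<subseteq> S} = card {A. A \<subseteq> V - T \<and> card A = k - card T}"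
    by (simp add: bij_betw_same_card)
  also have "\<dots> = (card V - card T) choose (k - card T)"
    using n_subsets[of "V - T" "k - card T"] assms fT by (simp add: card_Diff_subset)
  finally show ?thesis .
qed

lemma sum_ksets_ksets:
  fixes p :: "'a set \<Rightarrow> nat"
  assumes "finite V" "j \<le> k"
  shows "(\<Sum>S\<in>ksets V k. \<Sum>T\<in>ksets S j. p T) = ((card V - j) choose (k - j)) * (\<Sum>T\<in>ksets V j. p T)"
proof -
  have "(\<Sum>S\<in>ksets V k. \<Sum>T\<in>ksets S j. p T) = (\<Sum>S\<in>ksets V k. \<Sum>T | T \<in> ksets V j \<and> T \<subseteq> S. p T)"
    by (intro sum.cong refl arg_cong2[where f = sum]) (auto simp: ksets_def)
  also have "\<dots> = (\<Sum>T\<in>ksets V j. \<Sum>S | S \<in> ksets V k \<and> T \<subseteq> S. p T)"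
    using assms by (intro sum.swap_restrict) (auto simp: finite_ksets)
  also have "\<dots> = (\<Sum>T\<in>ksets V j. ((card V - j) choose (k - j)) * p T)"
  proof (intro sum.cong refl)
    fix T assume "T \<in> ksets V j"
    then have "card {S. S \<in> ksets V k \<and> T \<subseteq> S} = (card V - j) choose (k - j)"
      using card_supersets[OF assms(1), of T k] assms(2) by (simp add: ksets_def)
    then show "(\<Sum>S | S \<in> ksets V k \<and> T \<subseteq> S. p T) = ((card V - j) choose (k - j)) * p T" by simp
  qed
  finally show ?thesis by (simp add: sum_distrib_left)
qed

text \<open>Kelly's lemma: every \<open>j\<close>-subset lies in the same number of \<open>k\<close>-subsets.\<close>
lemma deck_sum_eq_le:
  fixes p :: "'a set \<Rightarrow> nat" and q :: "'b set \<Rightarrow> nat"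
  assumes fin: "finite V" "finite W" and c: "card V = card W" and deck: "deck k V E = deck k W F"
    and jk: "j \<le> k" "k \<le> card V"
    and inv: "\<And>S T g. S \<in> ksets V j \<Longrightarrow> T \<in> ksets W j \<Longrightarrow> iso_between g E S F T \<Longrightarrow> p S = q T"
  shows "(\<Sum>S\<in>ksets V j. p S) = (\<Sum>T\<in>ksets W j. q T)"
proof -
  \<comment> \<open>The sum of \<open>p\<close> over the \<open>j\<close>-subsets of a card is
    itself an invariant of that card, because an isomorphism of cards maps the
    \<open>j\<close>-subsets bijectively.\<close>
  have "(\<Sum>S\<in>ksets V k. \<Sum>T\<in>ksets S j. p T) = (\<Sum>S\<in>ksets W k. \<Sum>T\<in>ksets S j. q T)"
  proof (rule deck_sum_eq[OF fin deck])
    fix S T g assume S: "S \<in> ksets V k" and T: "T \<in> ksets W k" and iso: "iso_between g E S F T"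
    have b: "bij_betw g S T" using iso by (simp add: iso_between_def)
    have inj: "inj_on g S" and im: "g ` S = T" using b by (auto simp: bij_betw_def)
    have "bij_betw (image g) (ksets S j) (ksets T j)"
    proof -
      have bP: "bij_betw (image g) (Pow S) (Pow T)" by (rule bij_betw_Pow[OF b])
      have iK: "image g ` ksets S j = ksets T j"
      proof
        show "image g ` ksets S j \<subseteq> ksets T j"
          using im inj by (auto simp: ksets_def intro!: card_image inj_on_subset[OF inj])
        show "ksets T j \<subseteq> image g ` ksets S j"
        proof
          fix Y assume Y: "Y \<in> ksets T j"
          then obtain X where X: "X \<subseteq> S" "Y = g ` X" using im by (auto simp: ksets_def subset_image_iff)
          then have "card X = j" using Y inj by (auto simp: ksets_def card_image inj_on_subset)
          then show "Y \<in> image g ` ksets S j" using X by (auto simp: ksets_def)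
        qed
      qed
      have "ksets S j \<subseteq> Pow S" by (auto simp: ksets_def)
      then show ?thesis by (rule bij_betw_subset[OF bP _ iK])
    qed
    moreover have "p X = q (g ` X)" if X: "X \<in> ksets S j" for X
    proof (rule inv)
      show "X \<in> ksets V j" using X S by (auto simp: ksets_def)
      have "g ` X \<in> ksets T j" using calculation X by (auto simp: bij_betw_def)
      then show "g ` X \<in> ksets W j" using T by (auto simp: ksets_def)
      show "iso_between g E X F (g ` X)"
        using iso_between_restrict[OF iso] X by (simp add: ksets_def)
    qed
    ultimately show "(\<Sum>T\<in>ksets S j. p T) = (\<Sum>T\<in>ksets T j. q T)"
      using sum.reindex_bij_betw[of "image g" "ksets S j" "ksets T j" q] sum.cong[of "ksets S j" "ksets S j" p]
      by simp
  qed
  then have "((card V - j) choose (k - j)) * (\<Sum>S\<in>ksets V j. p S)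
      = ((card V - j) choose (k - j)) * (\<Sum>T\<in>ksets W j. q T)"
    using sum_ksets_ksets fin jk c by metis
  moreover have "0 < (card V - j) choose (k - j)" using jk by simp
  ultimately show ?thesis by simp
qed

section \<open>Cliques counted by their number of outside neighbours\<close>

definition touch :: "'a set set \<Rightarrow> 'a set \<Rightarrow> 'a set \<Rightarrow> 'a set" where
  "touch E V X = {y \<in> V - X. \<exists>x\<in>X. {x, y} \<in> E}"

text \<open>Used with \<open>f = 1\<close>, \<open>2\<close> and \<open>4\<close>: vertices, edges
  and copies of \<open>K4\<close>. For a single vertex, \<open>touch\<close> is its neighbourhood,
  so degrees are covered.\<close>

definition cliques :: "'a set set \<Rightarrow> 'a set \<Rightarrow> nat \<Rightarrow> 'a set set" where
  "cliques E V f = {X \<in> ksets V f. \<forall>x\<in>X. \<forall>y\<in>X. x \<noteq> y \<longrightarrow> {x, y} \<in> E}"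

lemma finite_cliques: "finite V \<Longrightarrow> finite (cliques E V f)"
  by (simp add: cliques_def finite_ksets)

text \<open>Such a \<open>T\<close> splits uniquely into \<open>X\<close>, \<open>s\<close> elements
  of \<open>N\<close> and \<open>t\<close> elements outside both, and the two selections are
  independent.\<close>

lemma card_bipartite_choice:
  assumes "finite V" "X \<subseteq> V" "N \<subseteq> V - X"
  shows "card {T \<in> ksets V (card X + s + t). X \<subseteq> T \<and> card (T \<inter> N) = s}
    = (card N choose s) * ((card V - card X - card N) choose t)"
proof -
  have fX: "finite X" and fN: "finite N" using assms by (meson finite_Diff finite_subset)+
  let ?M = "V - X - N"
  have fM: "finite ?M" using assms by simp
  have "bij_betw (\<lambda>(A, B). X \<union> A \<union> B) (ksets N s \<times> ksets ?M t)
      {T \<in> ksets V (card X + s + t). X \<subseteq> T \<and> card (T \<inter> N) = s}"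
  proof (rule bij_betwI[where g = "\<lambda>T. (T \<inter> N, T \<inter> ?M)"])
    show "(\<lambda>(A, B). X \<union> A \<union> B) \<in> ksets N s \<times> ksets ?M t
        \<rightarrow> {T \<in> ksets V (card X + s + t). X \<subseteq> T \<and> card (T \<inter> N) = s}"
    proof clarify
      fix A B assume A: "A \<in> ksets N s" and B: "B \<in> ksets ?M t"
      have f: "finite A" "finite B" using A B fN fM finite_subset unfolding ksets_def by blast+
      have "card (X \<union> A \<union> B) = card (X \<union> A) + card B"
        using f fX A B assms(3) by (intro card_Un_disjoint) (auto simp: ksets_def)
      also have "card (X \<union> A) = card X + card A"
        using f fX A assms(3) by (intro card_Un_disjoint) (auto simp: ksets_def)
      finally have "card (X \<union> A \<union> B) = card X + s + t" using A B by (simp add: ksets_def)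
      moreover have "(X \<union> A \<union> B) \<inter> N = A" using A B assms(3) by (auto simp: ksets_def)
      ultimately show "X \<union> A \<union> B \<in> ksets V (card X + s + t) \<and> X \<subseteq> X \<union> A \<union> B \<and> card ((X \<union> A \<union> B) \<inter> N) = s"
        using A B assms by (auto simp: ksets_def)
    qed
    show "(\<lambda>T. (T \<inter> N, T \<inter> ?M)) \<in> {T \<in> ksets V (card X + s + t). X \<subseteq> T \<and> card (T \<inter> N) = s}
        \<rightarrow> ksets N s \<times> ksets ?M t"
    proof
      fix T assume T: "T \<in> {T \<in> ksets V (card X + s + t). X \<subseteq> T \<and> card (T \<inter> N) = s}"
      then have TV: "T \<subseteq> V" and XT: "X \<subseteq> T" by (auto simp: ksets_def)
      have fT: "finite T" using TV assms(1) finite_subset by blast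
      have "T = X \<union> (T \<inter> N) \<union> (T \<inter> ?M)" using TV XT assms by auto
      moreover have "card (X \<union> (T \<inter> N) \<union> (T \<inter> ?M)) = card (X \<union> (T \<inter> N)) + card (T \<inter> ?M)"
        using fX fT assms by (intro card_Un_disjoint) auto
      moreover have "card (X \<union> (T \<inter> N)) = card X + card (T \<inter> N)"
        using fX fT assms by (intro card_Un_disjoint) auto
      ultimately have "card (T \<inter> ?M) = t" using T by (auto simp: ksets_def)
      then show "(T \<inter> N, T \<inter> ?M) \<in> ksets N s \<times> ksets ?M t" using T by (auto simp: ksets_def)
    qed
    show "(case (T \<inter> N, T \<inter> ?M) of (A, B) \<Rightarrow> X \<union> A \<union> B) = T"
      if "T \<in> {T \<in> ksets V (card X + s + t). X \<subseteq> T \<and> card (T \<inter> N) = s}" for T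
      using that assms by (auto simp: ksets_def)
    show "((case p of (A, B) \<Rightarrow> X \<union> A \<union> B) \<inter> N, (case p of (A, B) \<Rightarrow> X \<union> A \<union> B) \<inter> ?M) = p"
      if "p \<in> ksets N s \<times> ksets ?M t" for p
      using that assms by (auto simp: ksets_def)
  qed
  from bij_betw_same_card[OF this]
  have "card {T \<in> ksets V (card X + s + t). X \<subseteq> T \<and> card (T \<inter> N) = s}
      = card (ksets N s) * card (ksets ?M t)"
    by (simp only: card_cartesian_product)
  moreover have "card ?M = card V - card X - card N"
    using assms fX fN by (simp add: card_Diff_subset)
  ultimately show ?thesis using n_subsets[OF fN] n_subsets[OF fM] by (simp add: ksets_def)
qed

text \<open>Both sides count pairs of a clique \<open>X\<close> and a set \<open>T\<close> made of
  \<open>X\<close>, exactly \<open>s\<close> of its outside neighbours and \<open>t\<close>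
  non-neighbours. The left side groups the pairs by \<open>T\<close>, the right side by
  \<open>X\<close>.\<close>

lemma sum_touching_cliques:
  assumes "finite V"
  shows "(\<Sum>T\<in>ksets V (f + s + t). card {X \<in> cliques E T f. card (touch E T X) = s})
    = (\<Sum>X\<in>cliques E V f. (card (touch E V X) choose s) * ((card V - f - card (touch E V X)) choose t))"
proof -
  have "(\<Sum>T\<in>ksets V (f + s + t). card {X \<in> cliques E T f. card (touch E T X) = s})
      = (\<Sum>T\<in>ksets V (f + s + t). \<Sum>X | X \<in> cliques E V f \<and> X \<subseteq> T \<and> card (T \<inter> touch E V X) = s. 1)"
  proof (intro sum.cong refl)
    fix T assume T: "T \<in> ksets V (f + s + t)"
    have "touch E T X = T \<inter> touch E V X" for X using T by (auto simp: touch_def ksets_def)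
    then have "{X \<in> cliques E T f. card (touch E T X) = s}
        = {X. X \<in> cliques E V f \<and> X \<subseteq> T \<and> card (T \<inter> touch E V X) = s}"
      using T by (auto simp: cliques_def ksets_def)
    then show "card {X \<in> cliques E T f. card (touch E T X) = s}
        = (\<Sum>X | X \<in> cliques E V f \<and> X \<subseteq> T \<and> card (T \<inter> touch E V X) = s. 1)" by simp
  qed
  also have "\<dots> = (\<Sum>X\<in>cliques E V f. \<Sum>T | T \<in> ksets V (f + s + t) \<and> X \<subseteq> T \<and> card (T \<inter> touch E V X) = s. 1)"
    using assms by (intro sum.swap_restrict) (auto simp: finite_ksets finite_cliques)
  also have "\<dots> = (\<Sum>X\<in>cliques E V f. (card (touch E V X) choose s) * ((card V - f - card (touch E V X)) choose t))"
  proof (intro sum.cong refl)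
    fix X assume "X \<in> cliques E V f"
    then have X: "X \<subseteq> V" "card X = f" by (auto simp: cliques_def ksets_def)
    have "touch E V X \<subseteq> V - X" by (auto simp: touch_def)
    from card_bipartite_choice[OF assms X(1) this, of s t]
    show "(\<Sum>T | T \<in> ksets V (f + s + t) \<and> X \<subseteq> T \<and> card (T \<inter> touch E V X) = s. 1)
        = (card (touch E V X) choose s) * ((card V - f - card (touch E V X)) choose t)"
      using X by simp
  qed
  finally show ?thesis .
qed

lemma iso_between_touching_cliques:
  assumes iso: "iso_between g E S F T"
  shows "card {X \<in> cliques E S f. card (touch E S X) = s} = card {Y \<in> cliques F T f. card (touch F T Y) = s}"
proof -
  have b: "bij_betw g S T" and e: "\<And>x y. x \<in> S \<Longrightarrow> y \<in> S \<Longrightarrow> {x, y} \<in> E \<longleftrightarrow> {g x, g y} \<in> F"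
    using iso by (auto simp: iso_between_def)
  have inj: "inj_on g S" and im: "g ` S = T" using b by (auto simp: bij_betw_def)
  have injX: "inj_on g X" if "X \<subseteq> S" for X using that inj inj_on_subset by blast
  have t: "touch F T (g ` X) = g ` touch E S X" if X: "X \<subseteq> S" for X
  proof -
    have "g y \<in> g ` X \<longleftrightarrow> y \<in> X" if "y \<in> S" for y
      using inj that X by (simp add: inj_on_image_mem_iff)
    moreover have "(\<exists>x\<in>g ` X. {x, g y} \<in> F) \<longleftrightarrow> (\<exists>x\<in>X. {x, y} \<in> E)" if "y \<in> S" for y
      using e that X by (simp add: subset_eq)
    ultimately have "{y \<in> S. g y \<notin> g ` X \<and> (\<exists>x\<in>g ` X. {x, g y} \<in> F)} = touch E S X"
      unfolding touch_def by auto
    moreover have "{z \<in> g ` S. P z} = g ` {y \<in> S. P (g y)}" for P by blast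
    moreover have "touch F T (g ` X) = {z \<in> g ` S. z \<notin> g ` X \<and> (\<exists>x\<in>g ` X. {x, z} \<in> F)}"
      unfolding touch_def im[symmetric] by simp
    ultimately show ?thesis by simp
  qed
  have ct: "card (touch F T (g ` X)) = card (touch E S X)" if X: "X \<subseteq> S" for X
  proof -
    have "touch E S X \<subseteq> S" by (auto simp: touch_def)
    then show ?thesis using t[OF X] by (simp add: card_image injX)
  qed
  have cl: "g ` X \<in> cliques F T f \<longleftrightarrow> X \<in> cliques E S f" if X: "X \<subseteq> S" for X
  proof -
    have "card (g ` X) = card X" by (simp add: card_image injX X)
    moreover have "(\<forall>x\<in>g ` X. \<forall>y\<in>g ` X. x \<noteq> y \<longrightarrow> {x, y} \<in> F) \<longleftrightarrow> (\<forall>x\<in>X. \<forall>y\<in>X. x \<noteq> y \<longrightarrow> {x, y} \<in> E)"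
    proof -
      have "g x = g y \<longleftrightarrow> x = y" "{g x, g y} \<in> F \<longleftrightarrow> {x, y} \<in> E" if "x \<in> X" "y \<in> X" for x y
        using e that X inj by (auto simp: inj_on_def subset_eq)
      then show ?thesis by simp
    qed
    moreover have "g ` X \<subseteq> T" using X im by blast
    ultimately show ?thesis using X by (simp add: cliques_def ksets_def)
  qed
  have "image g ` {X \<in> cliques E S f. card (touch E S X) = s} = {Y \<in> cliques F T f. card (touch F T Y) = s}"
  proof
    show "image g ` {X \<in> cliques E S f. card (touch E S X) = s} \<subseteq> {Y \<in> cliques F T f. card (touch F T Y) = s}"
    proof clarify
      fix X assume X: "X \<in> cliques E S f" "s = card (touch E S X)"
      then have "X \<subseteq> S" by (simp add: cliques_def ksets_def)
      then show "g ` X \<in> cliques F T f \<and> card (touch F T (g ` X)) = card (touch E S X)"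
        using X cl ct by simp
    qed
    show "{Y \<in> cliques F T f. card (touch F T Y) = s} \<subseteq> image g ` {X \<in> cliques E S f. card (touch E S X) = s}"
    proof
      fix Y assume Y: "Y \<in> {Y \<in> cliques F T f. card (touch F T Y) = s}"
      then have "Y \<subseteq> g ` S" using im by (auto simp: cliques_def ksets_def)
      then obtain X where X: "X \<subseteq> S" "Y = g ` X" by (auto simp: subset_image_iff)
      then show "Y \<in> image g ` {X \<in> cliques E S f. card (touch E S X) = s}" using Y cl ct by auto
    qed
  qed
  moreover have "inj_on (image g) {X \<in> cliques E S f. card (touch E S X) = s}"
    by (rule inj_on_subset[OF inj_on_image_Pow[OF inj]]) (auto simp: cliques_def ksets_def)
  ultimately show ?thesis by (intro bij_betw_same_card[OF bij_betw_imageI])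
qed

text \<open>Grouped by \<open>T\<close>, the sum is a statistic of the cards on
  \<open>f + s + t\<close> vertices, so Kelly's lemma applies. As a function of the number
  \<open>r\<close> of outside neighbours each summand is a polynomial of degree
  \<open>s + t\<close>; taking \<open>t > 0\<close> makes it vanish for the largest values of
  \<open>r\<close>.\<close>

lemma clique_profile_eq:
  assumes fin: "finite V" "finite W" and c: "card V = card W" and deck: "deck k V E = deck k W F"
    and le: "f + s + t \<le> k" "k \<le> card V"
  shows "(\<Sum>X\<in>cliques E V f. (card (touch E V X) choose s) * ((card V - f - card (touch E V X)) choose t))
    = (\<Sum>X\<in>cliques F W f. (card (touch F W X) choose s) * ((card V - f - card (touch F W X)) choose t))"
proof -
  have "(\<Sum>T\<in>ksets V (f + s + t). card {X \<in> cliques E T f. card (touch E T X) = s})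
    = (\<Sum>T\<in>ksets W (f + s + t). card {X \<in> cliques F T f. card (touch F T X) = s})"
    by (rule deck_sum_eq_le[OF fin c deck le]) (rule iso_between_touching_cliques)
  then show ?thesis
    using sum_touching_cliques[OF fin(1), where E = E and f = f and s = s and t = t]
      sum_touching_cliques[OF fin(2), where E = F and f = f and s = s and t = t] c by simp
qed

section \<open>Connected vertex sets\<close>

text \<open>Connectedness stated by cuts instead of walks: it is then directly usable for growing a
  set by a vertex, for deleting vertices and for transport along isomorphisms.\<close>

definition conn :: "'a set set \<Rightarrow> 'a set \<Rightarrow> bool" where
  "conn E S \<longleftrightarrow> S \<noteq> {} \<and> (\<forall>X\<subseteq>S. X \<noteq> {} \<longrightarrow> X \<noteq> S \<longrightarrow> (\<exists>x\<in>X. \<exists>y\<in>S - X. {x, y} \<in> E))"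

lemma connD:
  assumes "conn E S" "X \<subseteq> S" "X \<noteq> {}" "X \<noteq> S"
  obtains x y where "x \<in> X" "y \<in> S" "y \<notin> X" "{x, y} \<in> E"
  using assms unfolding conn_def by blast

lemma connected_graph_iff_conn:
  assumes "simple_graph V E"
  shows "connected_graph V E \<longleftrightarrow> conn E V"
proof
  assume con: "connected_graph V E"
  show "conn E V"
    unfolding conn_def
  proof (intro conjI allI impI)
    show "V \<noteq> {}" using con by (simp add: connected_graph_def)
    fix X assume X: "X \<subseteq> V" "X \<noteq> {}" "X \<noteq> V"
    then obtain u v where uv: "u \<in> X" "v \<in> V" "v \<notin> X" by blast
    have "(\<lambda>x y. {x, y} \<in> E)\<^sup>*\<^sup>* u v" using con uv X unfolding connected_graph_def by blast
    \<comment> \<open>Invariant along the walk: its current end is in \<open>X\<close>, or an edge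
      from \<open>X\<close> to \<open>V - X\<close> has been found. Edges of a simple graph stay in
      \<open>V\<close>, so a step out of \<open>X\<close> ends in \<open>V - X\<close>.\<close>
    then have "v \<in> X \<or> (\<exists>x\<in>X. \<exists>y\<in>V - X. {x, y} \<in> E)"
    proof induction
      case (step y z)
      have "z \<in> V" using step(2) assms unfolding simple_graph_def by blast
      then show ?case using step by blast
    qed (use uv in simp)
    then show "\<exists>x\<in>X. \<exists>y\<in>V - X. {x, y} \<in> E" using uv by blast
  qed
next
  assume con: "conn E V"
  show "connected_graph V E"
    unfolding connected_graph_def
  proof (intro conjI ballI)
    show "V \<noteq> {}" using con by (simp add: conn_def)
    fix u v assume u: "u \<in> V" and v: "v \<in> V"
    define X where "X = {w \<in> V. (\<lambda>x y. {x, y} \<in> E)\<^sup>*\<^sup>* u w}"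
    have "X = V"
    proof (rule ccontr)
      assume "X \<noteq> V"
      moreover have "X \<subseteq> V" "X \<noteq> {}" using u by (auto simp: X_def)
      ultimately obtain x y where "x \<in> X" "y \<in> V" "y \<notin> X" "{x, y} \<in> E" using connD[OF con] by metis
      then show False unfolding X_def by (auto intro: rtranclp.rtrancl_into_rtrancl)
    qed
    then show "(\<lambda>x y. {x, y} \<in> E)\<^sup>*\<^sup>* u v" using v by (auto simp: X_def)
  qed
qed

lemma iso_between_sym:
  assumes "iso_between g E S F T"
  shows "iso_between (inv_into S g) F T E S"
proof -
  have b: "bij_betw g S T" using assms by (simp add: iso_between_def)
  have "inv_into S g y \<in> S" "g (inv_into S g y) = y" if "y \<in> T" for y
    using b that by (auto simp: bij_betw_def inv_into_into f_inv_into_f)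
  then show ?thesis using assms bij_betw_inv_into[OF b] unfolding iso_between_def by metis
qed

lemma conn_iso:
  assumes "iso_between g E S F T" "conn E S"
  shows "conn F T"
proof -
  have im: "g ` S = T" and e: "\<And>x y. x \<in> S \<Longrightarrow> y \<in> S \<Longrightarrow> {x, y} \<in> E \<longleftrightarrow> {g x, g y} \<in> F"
    using assms by (auto simp: iso_between_def bij_betw_def)
  show ?thesis
    unfolding conn_def
  proof (intro conjI allI impI)
    show "T \<noteq> {}" using assms im by (auto simp: conn_def)
    fix Y assume Y: "Y \<subseteq> T" "Y \<noteq> {}" "Y \<noteq> T"
    define X where "X = {x \<in> S. g x \<in> Y}"
    have "X \<subseteq> S" "X \<noteq> {}" "X \<noteq> S" using Y im by (auto simp: X_def)
    then obtain x y where "x \<in> X" "y \<in> S" "y \<notin> X" "{x, y} \<in> E" using connD[OF assms(2)] by metis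
    then show "\<exists>x\<in>Y. \<exists>y\<in>T - Y. {x, y} \<in> F" using e im unfolding X_def by blast
  qed
qed

definition conn_sets :: "'a set set \<Rightarrow> 'a set \<Rightarrow> nat \<Rightarrow> 'a set set" where
  "conn_sets E V k = {S \<in> ksets V k. conn E S}"

lemma finite_conn_sets: "finite V \<Longrightarrow> finite (conn_sets E V k)"
  by (simp add: conn_sets_def finite_ksets)

lemma card_conn_sets_eq:
  assumes fin: "finite V" "finite W" and deck: "deck k V E = deck k W F"
  shows "card (conn_sets E V k) = card (conn_sets F W k)"
proof -
  have "(\<Sum>S\<in>ksets V k. if conn E S then 1 else 0 :: nat) = (\<Sum>T\<in>ksets W k. if conn F T then 1 else 0)"
  proof (rule deck_sum_eq[OF fin deck])
    fix S T g assume "iso_between g E S F T"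
    then show "(if conn E S then 1 else 0 :: nat) = (if conn F T then 1 else 0)"
      using conn_iso[of g E S F T] conn_iso[OF iso_between_sym, of g E S F T] by auto
  qed
  then show ?thesis
    using fin by (simp add: conn_sets_def finite_ksets sum.If_cases Int_def)
qed

lemma conn_singleton: "conn E {v}"
  by (auto simp: conn_def)

lemma conn_insert:
  assumes "conn E S" "x \<in> S" "{x, y} \<in> E"
  shows "conn E (insert y S)"
proof (cases "y \<in> S")
  case True
  then show ?thesis using assms(1) by (simp add: insert_absorb)
next
  case y: False
  show ?thesis
    unfolding conn_def
  proof (intro conjI allI impI)
    fix X assume X: "X \<subseteq> insert y S" "X \<noteq> {}" "X \<noteq> insert y S"
    show "\<exists>a\<in>X. \<exists>b\<in>insert y S - X. {a, b} \<in> E"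
    proof (cases "X - {y} = {} \<or> S \<subseteq> X")
      case True
      then consider "X = {y}" | "S \<subseteq> X" "y \<notin> X" using X by blast
      then show ?thesis
      proof cases
        case 1
        then show ?thesis using assms(2,3) y by (auto simp: insert_commute)
      next
        case 2
        then show ?thesis using assms(2,3) by blast
      qed
    next
      case False
      then have "S \<inter> X \<subseteq> S" "S \<inter> X \<noteq> {}" "S \<inter> X \<noteq> S" using X by auto
      then obtain a b where "a \<in> S \<inter> X" "b \<in> S" "b \<notin> S \<inter> X" "{a, b} \<in> E" using connD[OF assms(1)] by metis
      then show ?thesis by blast
    qed
  qed simp
qed

lemma conn_grow:
  assumes "conn E V" "finite V" "conn E X" "X \<subseteq> V" "card X \<le> k" "k \<le> card V"
  obtains S where "X \<subseteq> S" "S \<in> conn_sets E V k"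
proof -
  have "\<exists>S. X \<subseteq> S \<and> S \<in> conn_sets E V k" using assms(5,6)
  proof (induction k rule: dec_induct)
    case base
    then show ?case using assms by (auto simp: conn_sets_def ksets_def)
  next
    case (step m)
    then obtain S where S: "X \<subseteq> S" "S \<subseteq> V" "card S = m" "conn E S"
      by (auto simp: conn_sets_def ksets_def)
    have "S \<noteq> V" "S \<noteq> {}" using S step by (auto simp: conn_def)
    then obtain x y where xy: "x \<in> S" "y \<in> V" "y \<notin> S" "{x, y} \<in> E" using connD[OF assms(1) S(2)] by metis
    have "finite S" using S assms(2) finite_subset by blast
    then have "card (insert y S) = Suc m" using xy S by simp
    then show ?case
      using conn_insert[OF S(4) xy(1,4)] S xy
      by (intro exI[of _ "insert y S"]) (auto simp: conn_sets_def ksets_def)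
  qed
  then show thesis using that by blast
qed

text \<open>A connection through \<open>Y\<close> enters and leaves by neighbours of
  \<open>Y\<close>. Where these are pairwise adjacent, \<open>Y\<close> can be bypassed.\<close>

lemma conn_remove:
  assumes S: "conn E S" and Y: "Y \<subseteq> S" "Y \<noteq> S"
    and cl: "\<And>p q. p \<in> touch E S Y \<Longrightarrow> q \<in> touch E S Y \<Longrightarrow> p \<noteq> q \<Longrightarrow> {p, q} \<in> E"
  shows "conn E (S - Y)"
  unfolding conn_def
proof (intro conjI allI impI)
  show "S - Y \<noteq> {}" using Y by blast
  fix X assume X: "X \<subseteq> S - Y" "X \<noteq> {}" "X \<noteq> S - Y"
  show "\<exists>a\<in>X. \<exists>b\<in>S - Y - X. {a, b} \<in> E"
  proof (cases "touch E S Y \<inter> X = {}")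
    case True
    obtain a b where ab: "a \<in> X" "b \<in> S" "b \<notin> X" "{a, b} \<in> E"
      using connD[OF S, of X] X by (metis Diff_subset dual_order.trans Diff_eq_empty_iff subset_antisym)
    have "b \<notin> Y"
    proof
      assume "b \<in> Y"
      then have "a \<in> touch E S Y" using ab X unfolding touch_def by (auto simp: insert_commute)
      then show False using True ab by blast
    qed
    then show ?thesis using ab by blast
  next
    case False
    then obtain p where p: "p \<in> touch E S Y" "p \<in> X" by blast
    \<comment> \<open>Enlarge the cut by \<open>Y\<close>. An edge leaving it from \<open>Y\<close>
      ends in a neighbour \<open>b\<close> of \<open>Y\<close>, and \<open>b\<close> is adjacent to
      the neighbour \<open>p\<close> of \<open>Y\<close> that lies in \<open>X\<close>.\<close>
    have "X \<union> Y \<subseteq> S" "X \<union> Y \<noteq> {}" "X \<union> Y \<noteq> S" using X Y by auto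
    then obtain a b where ab: "a \<in> X \<union> Y" "b \<in> S" "b \<notin> X \<union> Y" "{a, b} \<in> E" using connD[OF S] by metis
    show ?thesis
    proof (cases "a \<in> Y")
      case True
      then have "b \<in> touch E S Y" using ab unfolding touch_def by blast
      then have "{p, b} \<in> E" using cl p ab by blast
      then show ?thesis using p ab by blast
    qed (use ab in blast)
  qed
qed

text \<open>Grow one connected set from any vertex and a second one from a vertex that the first
  misses.\<close>

lemma two_conn_sets:
  assumes "conn E V" "finite V" "0 < k" "k < card V"
  shows "2 \<le> card (conn_sets E V k)"
proof -
  obtain v where "v \<in> V" using assms(1) by (auto simp: conn_def)
  then obtain S where S: "S \<in> conn_sets E V k"
    using conn_grow[OF assms(1,2) conn_singleton, of v k] assms by auto
  have "S \<noteq> V" "S \<subseteq> V" using S assms by (auto simp: conn_sets_def ksets_def)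
  then obtain y where y: "y \<in> V" "y \<notin> S" by blast
  then obtain T where T: "{y} \<subseteq> T" "T \<in> conn_sets E V k"
    using conn_grow[OF assms(1,2) conn_singleton, of y k] assms by auto
  have "card {S, T} \<le> card (conn_sets E V k)"
    using S T assms by (intro card_mono finite_conn_sets) auto
  moreover have "S \<noteq> T" using T y by blast
  ultimately show ?thesis by simp
qed

lemma conn_touch_nonempty:
  assumes "conn E V" "X \<subseteq> V" "X \<noteq> {}" "X \<noteq> V"
  shows "touch E V X \<noteq> {}"
  using connD[OF assms] unfolding touch_def by blast

lemma touch_mono: "S \<subseteq> V \<Longrightarrow> touch E S Y \<subseteq> touch E V Y"
  by (auto simp: touch_def)

lemma touch_subset: "touch E V X \<subseteq> V - X"
  by (auto simp: touch_def)

section \<open>Edges with exactly one outside neighbour\<close>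

lemma cliques_2E:
  assumes "X \<in> cliques E V 2"
  obtains u v where "X = {u, v}" "u \<noteq> v" "u \<in> V" "v \<in> V" "{u, v} \<in> E"
  using assms by (auto simp: cliques_def ksets_def card_2_iff)

text \<open>With \<open>u\<close> the single outside neighbour, such an edge is either the end of a
  path hanging off \<open>u\<close> or forms a triangle with \<open>u\<close>. These are the edges
  with \<open>r = 1\<close> in the overview.\<close>

definition pendant_edges :: "'a set set \<Rightarrow> 'a set \<Rightarrow> 'a set set" where
  "pendant_edges E V = {X \<in> cliques E V 2. card (touch E V X) = 1}"

text \<open>Let \<open>a\<close> be an end adjacent to the outside neighbour \<open>u\<close>. The
  other end \<open>b\<close> can only see \<open>a\<close> and \<open>u\<close>, which are adjacent,
  so \<open>conn_remove\<close> will apply to \<open>{b}\<close>.\<close>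

lemma pendant_edge_obtain_removable:
  assumes "X \<in> pendant_edges E V"
  obtains b where "b \<in> X" "\<And>p q. p \<in> touch E V {b} \<Longrightarrow> q \<in> touch E V {b} \<Longrightarrow> p \<noteq> q \<Longrightarrow> {p, q} \<in> E"
proof -
  have X: "X \<in> cliques E V 2" "card (touch E V X) = 1" using assms by (auto simp: pendant_edges_def)
  obtain u where u: "touch E V X = {u}" using X(2) card_1_singletonE by blast
  then obtain a where a: "a \<in> X" "{a, u} \<in> E" unfolding touch_def by blast
  obtain b where b: "X = {a, b}" "a \<noteq> b" "{a, b} \<in> E"
    using cliques_2E[OF X(1)] a(1) by (metis insertE insert_commute singletonD)
  have "touch E V {b} \<subseteq> {a, u}" using u b unfolding touch_def by auto
  then have "{p, q} \<in> E" if "p \<in> touch E V {b}" "q \<in> touch E V {b}" "p \<noteq> q" for p q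
    using that a(2) by (metis insertE insert_commute singletonD subsetD)
  then show thesis using that[of b] b(1) by blast
qed

text \<open>If \<open>{a, b}\<close> and \<open>{c, b}\<close> are both pendant, then
  \<open>c\<close> is the only outside neighbour of the first and \<open>a\<close> that of the
  second. So \<open>{a, b, c}\<close> has no outside neighbour and must be all of \<open>V\<close>,
  which is too large for that.\<close>

lemma pendant_edges_disjoint:
  assumes con: "conn E V" and fin: "finite V" and n: "4 \<le> card V"
    and X: "X \<in> pendant_edges E V" and Y: "Y \<in> pendant_edges E V" and ne: "X \<noteq> Y"
  shows "X \<inter> Y = {}"
proof (rule ccontr)
  assume "X \<inter> Y \<noteq> {}"
  then obtain b where b: "b \<in> X" "b \<in> Y" by blast
  have X2: "X \<in> cliques E V 2" "card (touch E V X) = 1" and Y2: "Y \<in> cliques E V 2" "card (touch E V Y) = 1"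
    using X Y by (auto simp: pendant_edges_def)
  obtain a where a: "X = {a, b}" "a \<noteq> b" "{a, b} \<in> E"
    using cliques_2E[OF X2(1)] b by (metis insertE insert_commute singletonD)
  obtain c where c: "Y = {c, b}" "c \<noteq> b" "{c, b} \<in> E"
    using cliques_2E[OF Y2(1)] b by (metis insertE insert_commute singletonD)
  have V: "a \<in> V" "b \<in> V" "c \<in> V" using a c X2 Y2 by (auto simp: cliques_def ksets_def)
  have ac: "a \<noteq> c" using ne a c by blast
  have "c \<in> touch E V X" using a c V ac by (auto simp: touch_def insert_commute)
  then have tX: "touch E V X = {c}" using X2(2) by (metis card_1_singletonE singletonD)
  have "a \<in> touch E V Y" using a c V ac by (auto simp: touch_def insert_commute)
  then have tY: "touch E V Y = {a}" using Y2(2) by (metis card_1_singletonE singletonD)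
  have "touch E V {a, b, c} = {}" using tX tY unfolding touch_def a c by blast
  then have "{a, b, c} = V" using conn_touch_nonempty[OF con, of "{a, b, c}"] V by blast
  moreover have "card {a, b, c} \<le> 3" by (simp add: card_insert_if)
  ultimately show False using n by simp
qed

text \<open>Deleting one pendant edge and a suitable vertex of another leaves a connected graph.\<close>
lemma pendant_edges_conn_sets:
  assumes con: "conn E V" and fin: "finite V" and n: "4 \<le> card V"
  shows "card (pendant_edges E V) * (card (pendant_edges E V) - 1) \<le> card (conn_sets E V (card V - 3))"
proof -
  let ?P = "pendant_edges E V"
  have finP: "finite ?P" using fin by (simp add: pendant_edges_def finite_cliques)
  have XV: "X \<subseteq> V" and X2: "card X = 2" if "X \<in> ?P" for X
    using that by (auto simp: pendant_edges_def cliques_def ksets_def)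
  have "\<exists>b. \<forall>X\<in>?P. b X \<in> X \<and> (\<forall>p\<in>touch E V {b X}. \<forall>q\<in>touch E V {b X}. p \<noteq> q \<longrightarrow> {p, q} \<in> E)"
    by (rule bchoice) (meson pendant_edge_obtain_removable)
  then obtain b where b: "\<And>X. X \<in> ?P \<Longrightarrow> b X \<in> X"
    and bt: "\<And>X p q. X \<in> ?P \<Longrightarrow> p \<in> touch E V {b X} \<Longrightarrow> q \<in> touch E V {b X} \<Longrightarrow> p \<noteq> q \<Longrightarrow> {p, q} \<in> E"
    by blast
  note disj = pendant_edges_disjoint[OF con fin n]
  \<comment> \<open>Ordered pairs of distinct pendant edges: the first loses both ends, the second
    only its removable end.\<close>
  let ?Q = "?P \<times> ?P - Id_on ?P"
  have im: "(\<lambda>(X, Y). V - (X \<union> {b Y})) ` ?Q \<subseteq> conn_sets E V (card V - 3)"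
  proof clarify
    fix X Y assume X: "X \<in> ?P" and Y: "Y \<in> ?P" and ne: "(X, Y) \<notin> Id_on ?P"
    then have d: "X \<inter> Y = {}" using disj by blast
    have fX: "finite X" using XV[OF X] fin finite_subset by blast
    have bY: "b Y \<in> V" "b Y \<notin> X" using b[OF Y] d XV[OF Y] by auto
    have cXb: "card (X \<union> {b Y}) = 3" using X2[OF X] bY fX by simp
    have c: "card (V - (X \<union> {b Y})) = card V - 3"
      using XV[OF X] bY fX cXb by (subst card_Diff_subset) auto
    have "conn E (V - X)"
    proof (rule conn_remove[OF con XV[OF X]])
      show "X \<noteq> V" using X2[OF X] n by auto
      show "{p, q} \<in> E" if "p \<in> touch E V X" "q \<in> touch E V X" "p \<noteq> q" for p q
        using X that unfolding pendant_edges_def by (auto simp: card_1_singleton_iff)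
    qed
    \<comment> \<open>Inside \<open>V - X\<close> the vertex \<open>b Y\<close> has no neighbours
      beyond those in \<open>V\<close>, so they are still pairwise adjacent.\<close>
    then have "conn E (V - X - {b Y})"
    proof (rule conn_remove)
      show "{b Y} \<subseteq> V - X" using bY by simp
      have "card (V - X) = card V - 2" using X2[OF X] XV[OF X] fX by (simp add: card_Diff_subset)
      then have "1 < card (V - X)" using n by simp
      then show "{b Y} \<noteq> V - X" by (metis card.empty card_insert_disjoint empty_iff finite.emptyI less_irrefl One_nat_def)
      show "{p, q} \<in> E" if "p \<in> touch E (V - X) {b Y}" "q \<in> touch E (V - X) {b Y}" "p \<noteq> q" for p q
        using bt[OF Y] that touch_mono[of "V - X" V E "{b Y}"] by blast
    qed
    moreover have "V - X - {b Y} = V - (X \<union> {b Y})" by blast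
    ultimately show "V - (X \<union> {b Y}) \<in> conn_sets E V (card V - 3)"
      using c by (auto simp: conn_sets_def ksets_def)
  qed
  have inj: "inj_on (\<lambda>(X, Y). V - (X \<union> {b Y})) ?Q"
  proof (rule inj_onI, clarify)
    fix X Y X' Y'
    assume X: "X \<in> ?P" and Y: "Y \<in> ?P" and X': "X' \<in> ?P" and Y': "Y' \<in> ?P"
      and ne: "(X, Y) \<notin> Id_on ?P" "(X', Y') \<notin> Id_on ?P"
      and eq: "V - (X \<union> {b Y}) = V - (X' \<union> {b Y'})"
    have "X \<union> {b Y} \<subseteq> V" "X' \<union> {b Y'} \<subseteq> V" using XV X Y X' Y' b by blast+
    then have eq': "X \<union> {b Y} = X' \<union> {b Y'}" using eq by blast
    \<comment> \<open>The deleted triple determines the pair: were \<open>X\<close> and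
      \<open>X'\<close> different, they would be disjoint and the two elements of \<open>X'\<close>
      would have to fit into \<open>{b Y}\<close>.\<close>
    have XX: "X = X'"
    proof (rule ccontr)
      assume "X \<noteq> X'"
      then have "X' \<subseteq> {b Y}" using disj[OF X X'] eq' by blast
      then have "card X' \<le> 1" by (metis card_mono card.empty card_insert_disjoint empty_iff finite.intros One_nat_def)
      then show False using X2[OF X'] by simp
    qed
    have "b Y \<notin> X" "b Y' \<notin> X'" using disj[OF X Y] disj[OF X' Y'] b X Y X' Y' ne by (auto simp: Id_on_def)
    then have "b Y = b Y'" using eq' XX by blast
    then have "Y \<inter> Y' \<noteq> {}" using b[OF Y] b[OF Y'] by auto
    then show "X = X' \<and> Y = Y'" using XX disj[OF Y Y'] by auto
  qed
  have "card ?Q \<le> card (conn_sets E V (card V - 3))"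
    by (rule card_inj_on_le[OF inj im finite_conn_sets[OF fin]])
  moreover have "card ?Q = card ?P * (card ?P - 1)"
  proof -
    have "Id_on ?P = (\<lambda>X. (X, X)) ` ?P" by (auto simp: Id_on_def)
    moreover have "card ((\<lambda>X. (X, X)) ` ?P) = card ?P" by (intro card_image inj_onI) simp
    ultimately have "card ?Q = card (?P \<times> ?P) - card ?P"
      using finP card_Diff_subset[of "Id_on ?P" "?P \<times> ?P"] by (simp add: image_subset_iff)
    then show ?thesis by (simp add: card_cartesian_product diff_mult_distrib2)
  qed
  ultimately show ?thesis by simp
qed

section \<open>Connected sets containing a given connected set\<close>

lemma conn_Un_touch:
  assumes "conn E C" "finite A" "A \<subseteq> touch E V C"
  shows "conn E (C \<union> A)"
  using assms(2,3)
proof (induction A rule: finite_induct)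
  case (insert a A)
  then obtain x where "x \<in> C" "{x, a} \<in> E" unfolding touch_def by blast
  then show ?case using conn_insert[of E "C \<union> A" x a] insert by simp
qed (use assms(1) in simp)

text \<open>The walk is given as an indexed sequence because the injection in
  \<open>card_conn_sets_over_insert\<close> needs the last index at which it meets a set.\<close>

lemma conn_walk:
  assumes con: "conn E V" and C: "C \<subseteq> V" "C \<noteq> {}" and s: "s \<in> V"
  shows "\<exists>(p :: nat \<Rightarrow> 'a) l. p 0 \<in> C \<and> p l = s \<and> (\<forall>i<l. {p i, p (Suc i)} \<in> E) \<and> (\<forall>i\<le>l. p i \<in> V)"
proof -
  define R where "R = {s \<in> V. \<exists>(p :: nat \<Rightarrow> 'a) l. p 0 \<in> C \<and> p l = s \<and> (\<forall>i<l. {p i, p (Suc i)} \<in> E) \<and> (\<forall>i\<le>l. p i \<in> V)}"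
  have CR: "C \<subseteq> R"
  proof
    fix c assume "c \<in> C"
    then show "c \<in> R" unfolding R_def using C by (auto intro!: exI[of _ "\<lambda>_. c"] exI[of _ 0])
  qed
  have "R = V"
  proof (rule ccontr)
    assume "R \<noteq> V"
    moreover have "R \<subseteq> V" "R \<noteq> {}" using CR C by (auto simp: R_def)
    ultimately obtain x y where xy: "x \<in> R" "y \<in> V" "y \<notin> R" "{x, y} \<in> E" using connD[OF con] by metis
    then obtain p l where p: "p 0 \<in> C" "p l = x" "\<forall>i<l. {p i, p (Suc i)} \<in> E" "\<forall>i\<le>l. p i \<in> V"
      unfolding R_def by blast
    have "y \<in> R" unfolding R_def
      using p xy by (auto intro!: exI[of _ "p(Suc l := y)"] exI[of _ "Suc l"] simp: less_Suc_eq le_Suc_eq)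
    then show False using xy by simp
  qed
  then show ?thesis using s unfolding R_def by blast
qed

definition conn_sets_over :: "'a set set \<Rightarrow> 'a set \<Rightarrow> 'a set \<Rightarrow> nat \<Rightarrow> 'a set set" where
  "conn_sets_over E C V k = {S \<in> conn_sets E V k. C \<subseteq> S}"

lemma finite_conn_sets_over: "finite V \<Longrightarrow> finite (conn_sets_over E C V k)"
  by (simp add: conn_sets_over_def finite_conn_sets)

text \<open>The new vertex \<open>x\<close> hangs off \<open>s\<close>. A connected set containing \<open>s\<close> is extended by \<open>x\<close>; any other one
  is extended by the vertex following its last vertex on a fixed walk from \<open>C\<close> to \<open>s\<close>, which can be
  recovered from the result.\<close>
lemma card_conn_sets_over_insert:
  assumes con: "conn E V" and fin: "finite V" and C: "C \<subseteq> V" "C \<noteq> {}"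
    and x: "x \<notin> V" "s \<in> V" "{s, x} \<in> E"
  shows "card (conn_sets_over E C V k) \<le> card (conn_sets_over E C (insert x V) (Suc k))"
proof -
  obtain p l where p: "p 0 \<in> C" "p l = s" "\<forall>i<l. {p i, p (Suc i)} \<in> E" "\<forall>i\<le>l. p i \<in> V"
    using conn_walk[OF con C x(2)] by blast
  \<comment> \<open>The last index of the walk inside \<open>S\<close>. It exists whenever
    \<open>S\<close> contains \<open>C\<close>, since the walk starts in \<open>C\<close>.\<close>
  define m where "m S = Max {i. i \<le> l \<and> p i \<in> S}" for S
  have mfin: "finite {i. i \<le> l \<and> p i \<in> S}" for S by simp
  have mprop: "m S \<le> l \<and> p (m S) \<in> S" if "C \<subseteq> S" for S
  proof -
    have "{i. i \<le> l \<and> p i \<in> S} \<noteq> {}" using p(1) that by blast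
    from Max_in[OF mfin this] show ?thesis unfolding m_def by blast
  qed
  have mmax: "i \<le> m S" if "i \<le> l" "p i \<in> S" for i S
    unfolding m_def using that by (intro Max_ge mfin) simp
  define h where "h S = (if s \<in> S then insert x S else insert (p (Suc (m S))) S)" for S
  have nxt: "m S < l" "p (Suc (m S)) \<in> V" "p (Suc (m S)) \<notin> S" "{p (m S), p (Suc (m S))} \<in> E"
    if "C \<subseteq> S" "s \<notin> S" for S
  proof -
    show l: "m S < l" using mprop[OF that(1)] that(2) p(2) by (metis le_neq_implies_less)
    then show "p (Suc (m S)) \<in> V" "{p (m S), p (Suc (m S))} \<in> E" using p by auto
    show "p (Suc (m S)) \<notin> S" using mmax[of "Suc (m S)" S] l by auto
  qed
  have "h ` conn_sets_over E C V k \<subseteq> conn_sets_over E C (insert x V) (Suc k)"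
  proof clarify
    fix S assume "S \<in> conn_sets_over E C V k"
    then have S: "S \<subseteq> V" "card S = k" "conn E S" "C \<subseteq> S"
      by (auto simp: conn_sets_over_def conn_sets_def ksets_def)
    have fS: "finite S" using S fin finite_subset by blast
    show "h S \<in> conn_sets_over E C (insert x V) (Suc k)"
    proof (cases "s \<in> S")
      case True
      then have "conn E (insert x S)" using conn_insert[OF S(3)] x by blast
      moreover have "x \<notin> S" using S x by blast
      ultimately show ?thesis using S True fS by (auto simp: h_def conn_sets_over_def conn_sets_def ksets_def)
    next
      case False
      have "conn E (insert (p (Suc (m S))) S)"
        using conn_insert[OF S(3)] mprop[OF S(4)] nxt[OF S(4) False] by blast
      then show ?thesis using S False fS nxt[OF S(4) False]
        by (auto simp: h_def conn_sets_over_def conn_sets_def ksets_def)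
    qed
  qed
  moreover have "inj_on h (conn_sets_over E C V k)"
  proof (rule inj_onI)
    \<comment> \<open>The vertex added to \<open>S\<close> is the last walk vertex in
      \<open>h S\<close>: the index \<open>m (h S)\<close> exceeds \<open>m S\<close>, so its vertex
      is not in \<open>S\<close> and must be the new one.\<close>
    have last: "S = h S - {p (m (h S))}" if "C \<subseteq> S" "s \<notin> S" for S
    proof -
      have h: "h S = insert (p (Suc (m S))) S" using that by (simp add: h_def)
      have "Suc (m S) \<le> m (h S)" using mmax[of "Suc (m S)" "h S"] nxt(1)[OF that] h by simp
      then have "p (m (h S)) \<notin> S" using mmax[of "m (h S)" S] mprop[of "h S"] that h by fastforce
      moreover have "p (m (h S)) \<in> h S" using mprop[of "h S"] that h by blast
      ultimately have "p (m (h S)) = p (Suc (m S))" using h by blast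
      then show ?thesis using h nxt(3)[OF that] by auto
    qed
    fix S T assume "S \<in> conn_sets_over E C V k" "T \<in> conn_sets_over E C V k" and eq: "h S = h T"
    then have S: "C \<subseteq> S" "S \<subseteq> V" and T: "C \<subseteq> T" "T \<subseteq> V"
      by (auto simp: conn_sets_over_def conn_sets_def ksets_def)
    \<comment> \<open>Walk vertices lie in \<open>V\<close> and \<open>x\<close> does not, so the
      presence of \<open>x\<close> in the result tells which of the two extensions was used.\<close>
    have xh: "x \<in> h U \<longleftrightarrow> s \<in> U" if "C \<subseteq> U" "U \<subseteq> V" for U
      using x(1) that nxt(2)[of U] by (auto simp: h_def)
    show "S = T"
    proof (cases "s \<in> S")
      case True
      then have "s \<in> T" using xh S T eq by metis
      then show ?thesis using True eq x S T by (auto simp: h_def)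
    next
      case False
      then have "s \<notin> T" using xh S T eq by metis
      then show ?thesis using last S(1) T(1) False eq by metis
    qed
  qed
  ultimately show ?thesis using card_inj_on_le finite_conn_sets_over fin by (metis finite_insert)
qed

text \<open>Any two of four outside neighbours may be added to \<open>C\<close>, giving 6 sets. For
  an edge \<open>C\<close> and 7 vertices these are sets of size \<open>n - 3\<close>.\<close>

lemma card_conn_sets_over_pairs:
  assumes C: "conn E C" "C \<subseteq> V" and fin: "finite V" and W: "4 \<le> card (touch E V C)"
  shows "6 \<le> card (conn_sets_over E C V (card C + 2))"
proof -
  obtain W4 where W4: "W4 \<subseteq> touch E V C" "card W4 = 4" "finite W4" using W by (meson obtain_subset_with_card_n)
  have fC: "finite C" using C fin finite_subset by blast
  have "(\<lambda>A. C \<union> A) ` ksets W4 2 \<subseteq> conn_sets_over E C V (card C + 2)"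
  proof clarify
    fix A assume A: "A \<in> ksets W4 2"
    then have "A \<subseteq> touch E V C" "finite A" using W4 by (auto simp: ksets_def intro: finite_subset)
    then have "conn E (C \<union> A)" "A \<subseteq> V - C" using conn_Un_touch[OF C(1)] touch_subset[of E V C] by auto
    moreover have "card (C \<union> A) = card C + card A"
      using \<open>A \<subseteq> V - C\<close> fC \<open>finite A\<close> by (intro card_Un_disjoint) auto
    ultimately show "C \<union> A \<in> conn_sets_over E C V (card C + 2)"
      using A C by (auto simp: conn_sets_over_def conn_sets_def ksets_def)
  qed
  moreover have "inj_on (\<lambda>A. C \<union> A) (ksets W4 2)"
    using W4(1) touch_subset[of E V C] unfolding inj_on_def ksets_def by blast
  ultimately have "card (ksets W4 2) \<le> card (conn_sets_over E C V (card C + 2))"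
    by (intro card_inj_on_le finite_conn_sets_over fin)
  moreover have "card (ksets W4 2) = 6" using n_subsets[OF W4(3), of 2] W4(2) by (simp add: ksets_def choose_two)
  ultimately show ?thesis by simp
qed

text \<open>The smallest case: six vertices beyond \<open>C\<close>, of which three are chosen. The
  eight choices are the 4 triples inside \<open>W4\<close>, the 3 triples \<open>{x, w1, w}\<close>
  where \<open>w1\<close> secures the connection of \<open>x\<close>, and one triple containing
  \<open>y\<close>.\<close>

lemma card_conn_sets_over_six:
  assumes C: "conn E C" "finite C" and W4: "W4 \<subseteq> touch E U C" "card W4 = 4" "finite W4"
    and x: "x \<notin> C \<union> W4" "z \<in> C \<union> W4" "{z, x} \<in> E"
    and y: "y \<notin> insert x (C \<union> W4)" "z' \<in> insert x (C \<union> W4)" "{z', y} \<in> E"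
  shows "8 \<le> card (conn_sets_over E C (insert y (insert x (C \<union> W4))) (card C + 3))"
proof -
  have c3: "card {a, b, c} = 3" if "a \<noteq> b" "a \<noteq> c" "b \<noteq> c" for a b c :: 'a
    using that by simp
  have dC: "C \<inter> W4 = {}" using W4 touch_subset[of E U C] by blast
  have conA: "conn E (C \<union> A)" if "A \<subseteq> W4" for A
    using conn_Un_touch[OF C(1), of A U] that W4 finite_subset by blast
  \<comment> \<open>The attachment point \<open>z\<close> of \<open>x\<close> lies in
    \<open>W4\<close> or in \<open>C\<close>. In the first case \<open>w1\<close> is
    \<open>z\<close>, in the second it is arbitrary; either way \<open>x\<close> is attached to
    \<open>C\<close> together with \<open>w1\<close>.\<close>
  obtain w1 where w1: "w1 \<in> W4" "z \<in> insert w1 C"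
  proof (cases "z \<in> W4")
    case False
    moreover obtain w where "w \<in> W4" using W4(2) by fastforce
    ultimately show thesis using that x(2) by blast
  qed (use that in blast)
  have conx: "conn E (C \<union> insert x A)" if "A \<subseteq> W4" "w1 \<in> A" for A
    using conn_insert[OF conA[OF that(1)], of z x] w1 that x(3) by auto
  have ex2: "\<exists>w'\<in>W4. w' \<noteq> w" for w
  proof (rule ccontr)
    assume "\<not> (\<exists>w'\<in>W4. w' \<noteq> w)"
    then have "W4 \<subseteq> {w}" by blast
    then have "card W4 \<le> card {w}" by (intro card_mono) auto
    then show False using W4(2) by simp
  qed
  \<comment> \<open>One triple with \<open>y\<close> suffices. The two companions of
    \<open>y\<close> depend on where \<open>y\<close> is attached, and containing \<open>y\<close>
    keeps the triple apart from the other seven.\<close>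
  obtain A3 where A3: "y \<in> A3" "card A3 = 3" "A3 \<subseteq> insert y (insert x W4)" "conn E (C \<union> A3)"
  proof -
    consider "z' = x" | "z' \<in> W4" | "z' \<in> C" using y(2) by blast
    then show thesis
    proof cases
      case 1
      have "conn E (C \<union> insert x {w1})" using conx[of "{w1}"] w1 by simp
      then have "conn E (insert y (C \<union> {x, w1}))" by (rule conn_insert[where x = x]) (use 1 y(3) in auto)
      moreover have "card {y, x, w1} = 3" using x y w1 by (intro c3) auto
      ultimately show thesis using that[of "{y, x, w1}"] w1 by simp
    next
      case 2
      obtain w where w: "w \<in> W4" "w \<noteq> z'" using ex2 by blast
      then have "conn E (C \<union> {z', w})" using conA[of "{z', w}"] 2 by simp
      then have "conn E (insert y (C \<union> {z', w}))" by (rule conn_insert[where x = z']) (use y(3) in auto)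
      moreover have "card {y, z', w} = 3" using y w 2 by (intro c3) auto
      ultimately show thesis using that[of "{y, z', w}"] w 2 by simp
    next
      case 3
      obtain w where w: "w \<in> W4" "w \<noteq> w1" using ex2 by blast
      then have "conn E (C \<union> {w1, w})" using conA[of "{w1, w}"] w1 by simp
      then have "conn E (insert y (C \<union> {w1, w}))" by (rule conn_insert[where x = z']) (use 3 y(3) in auto)
      moreover have "card {y, w1, w} = 3" using y w w1 by (intro c3) auto
      ultimately show thesis using that[of "{y, w1, w}"] w w1 by simp
    qed
  qed
  define F1 where "F1 = ksets W4 3"
  define F2 where "F2 = (\<lambda>w. {x, w1, w}) ` (W4 - {w1})"
  define F where "F = F1 \<union> F2 \<union> {A3}"
  have c1: "card F1 = 4" unfolding F1_def
    using n_subsets[OF W4(3), of 3] W4(2) by (simp add: ksets_def numeral_eq_Suc)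
  have "inj_on (\<lambda>w. {x, w1, w}) (W4 - {w1})"
  proof (rule inj_onI)
    fix a b assume ab: "a \<in> W4 - {w1}" "b \<in> W4 - {w1}" and eq: "{x, w1, a} = {x, w1, b}"
    have "a \<in> {x, w1, b}" unfolding eq[symmetric] by simp
    then show "a = b" using ab x(1) by auto
  qed
  then have c2: "card F2 = 3" unfolding F2_def using W4 w1 by (simp add: card_image)
  have f: "finite F1" "finite F2" using W4 by (auto simp: F1_def F2_def finite_ksets)
  have d: "F1 \<inter> F2 = {}" "A3 \<notin> F1 \<union> F2"
    using x(1) y(1) A3(1) w1 by (auto simp: F1_def F2_def ksets_def)
  have cF: "card F = 8"
    using c1 c2 f d card_Un_disjoint[of F1 F2] by (simp add: F_def)
  have sub: "A \<subseteq> insert y (insert x W4)" "card A = 3" "conn E (C \<union> A)" if A: "A \<in> F" for A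
  proof -
    consider "A \<in> F1" | w where "w \<in> W4" "w \<noteq> w1" "A = {x, w1, w}" | "A = A3"
      using A by (auto simp: F_def F2_def)
    then have "A \<subseteq> insert y (insert x W4) \<and> card A = 3 \<and> conn E (C \<union> A)"
    proof cases
      case 1
      then show ?thesis using conA by (auto simp: F1_def ksets_def)
    next
      case 2
      then have "card A = 3" using x w1 c3[of x w1 w] by blast
      moreover have "conn E (C \<union> insert x {w1, w})" using conx[of "{w1, w}"] w1 2 by simp
      ultimately show ?thesis using 2 w1 by auto
    next
      case 3
      then show ?thesis using A3 by blast
    qed
    then show "A \<subseteq> insert y (insert x W4)" "card A = 3" "conn E (C \<union> A)" by auto
  qed
  have disjC: "C \<inter> insert y (insert x W4) = {}" using dC x y by auto
  have "(\<lambda>A. C \<union> A) ` F \<subseteq> conn_sets_over E C (insert y (insert x (C \<union> W4))) (card C + 3)"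
  proof clarify
    fix A assume A: "A \<in> F"
    have "finite A" using sub(2)[OF A] card.infinite by fastforce
    then have "card (C \<union> A) = card C + card A"
      using sub(1)[OF A] disjC C(2) by (intro card_Un_disjoint) auto
    then show "C \<union> A \<in> conn_sets_over E C (insert y (insert x (C \<union> W4))) (card C + 3)"
      using sub[OF A] by (auto simp: conn_sets_over_def conn_sets_def ksets_def)
  qed
  moreover have "inj_on (\<lambda>A. C \<union> A) F"
  proof (rule inj_onI)
    fix A B assume "A \<in> F" "B \<in> F" "C \<union> A = C \<union> B"
    moreover have "A \<inter> C = {}" "B \<inter> C = {}" using sub(1) calculation disjC by blast+
    ultimately show "A = B" by blast
  qed
  ultimately have "card F \<le> card (conn_sets_over E C (insert y (insert x (C \<union> W4))) (card C + 3))"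
    using C W4 by (intro card_inj_on_le finite_conn_sets_over) auto
  then show ?thesis using cF by simp
qed

text \<open>Reach \<open>V\<close> from \<open>C\<close> through connected sets: first four outside
  neighbours and two further vertices, where eight sets are explicit, then one vertex at a time by
  \<open>card_conn_sets_over_insert\<close>.\<close>

lemma card_conn_sets_over_ge_8:
  assumes con: "conn E V" and fin: "finite V" and C: "conn E C" "C \<subseteq> V"
    and W: "4 \<le> card (touch E V C)" and n: "card C + 6 \<le> card V"
  shows "8 \<le> card (conn_sets_over E C V (card V - 3))"
proof -
  obtain W4 where W4: "W4 \<subseteq> touch E V C" "card W4 = 4" "finite W4" using W by (meson obtain_subset_with_card_n)
  have fC: "finite C" using C fin finite_subset by blast
  have W4V: "W4 \<subseteq> V - C" using W4 touch_subset[of E V C] by blast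
  have Cne: "C \<noteq> {}" using C by (auto simp: conn_def)
  let ?U = "C \<union> W4"
  have cU: "card ?U = card C + 4" using W4 W4V fC by (subst card_Un_disjoint) auto
  have conU: "conn E ?U" using conn_Un_touch[OF C(1)] W4 by blast
  have UV: "?U \<subseteq> V" "?U \<noteq> {}" "?U \<noteq> V" using C W4V Cne cU n by auto
  then obtain z x where x: "z \<in> ?U" "x \<in> V" "x \<notin> ?U" "{z, x} \<in> E" using connD[OF con] by metis
  let ?U1 = "insert x ?U"
  have conU1: "conn E ?U1" using conn_insert[OF conU] x by blast
  have cU1: "card ?U1 = card C + 5" using cU x fC W4 by simp
  have U1V: "?U1 \<subseteq> V" "?U1 \<noteq> {}" "?U1 \<noteq> V" using UV x cU1 n by auto
  then obtain z' y where y: "z' \<in> ?U1" "y \<in> V" "y \<notin> ?U1" "{z', y} \<in> E" using connD[OF con] by metis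
  let ?U2 = "insert y ?U1"
  have conU2: "conn E ?U2" using conn_insert[OF conU1] y by blast
  have cU2: "card ?U2 = card C + 6" using cU1 y fC W4 by simp
  have base: "8 \<le> card (conn_sets_over E C ?U2 (card ?U2 - 3))"
    using card_conn_sets_over_six[OF C(1) fC W4 x(3) x(1) x(4) y(3) y(1) y(4)] cU2 by (simp add: add.commute)
  \<comment> \<open>The size of the counted sets grows along with \<open>U\<close>, so three
    vertices of \<open>U\<close> are left out at every stage.\<close>
  have "\<exists>U. U \<subseteq> V \<and> card U = m \<and> conn E U \<and> C \<subseteq> U \<and> 8 \<le> card (conn_sets_over E C U (m - 3))"
    if "card C + 6 \<le> m" "m \<le> card V" for m
    using that
  proof (induction m rule: dec_induct)
    case base
    show ?case
      by (rule exI[of _ ?U2]) (use U1V y conU2 cU2 \<open>8 \<le> card (conn_sets_over E C ?U2 (card ?U2 - 3))\<close> in auto)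
  next
    case (step m)
    then obtain U where U: "U \<subseteq> V" "card U = m" "conn E U" "C \<subseteq> U" "8 \<le> card (conn_sets_over E C U (m - 3))" by auto
    have fU: "finite U" using U fin finite_subset by blast
    have "U \<noteq> V" "U \<noteq> {}" using U step Cne by auto
    then obtain s v where v: "s \<in> U" "v \<in> V" "v \<notin> U" "{s, v} \<in> E" using connD[OF con U(1)] by metis
    have "card (conn_sets_over E C U (m - 3)) \<le> card (conn_sets_over E C (insert v U) (Suc (m - 3)))"
      by (rule card_conn_sets_over_insert[OF U(3) fU U(4) Cne v(3) v(1) v(4)])
    moreover have "Suc (m - 3) = Suc m - 3" using step by simp
    ultimately have "8 \<le> card (conn_sets_over E C (insert v U) (Suc m - 3))" using U(5) by simp
    then show ?case using U v fU conn_insert[OF U(3) v(1) v(4)]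
      by (intro exI[of _ "insert v U"]) auto
  qed
  from this[of "card V"] n obtain U where U: "U \<subseteq> V" "card U = card V" "8 \<le> card (conn_sets_over E C U (card V - 3))"
    by auto
  have "U = V" using card_subset_eq[OF fin U(1,2)] .
  then show ?thesis using U by simp
qed

text \<open>If \<open>v\<close> lies on an edge \<open>{v, w}\<close> of \<open>B\<close>, then
  every neighbour of \<open>v\<close> is \<open>w\<close> or one of the at most \<open>d\<close>
  outside neighbours of that edge. So \<open>v\<close> lies on at most \<open>d + 1\<close> edges of
  \<open>B\<close>, and counting incidences gives the bound.\<close>

lemma card_edges_small_touch:
  assumes fin: "finite V" and B: "B \<subseteq> {X \<in> cliques E V 2. card (touch E V X) \<le> d}"
  shows "2 * card B \<le> (d + 1) * card V"
proof -
  have fB: "finite B" using B fin finite_cliques[of V E 2] finite_subset by fastforce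
  have deg: "card {X \<in> B. v \<in> X} \<le> d + 1" for v
  proof (cases "{X \<in> B. v \<in> X} = {}")
    case False
    then obtain X where X: "X \<in> B" "v \<in> X" by blast
    then have X2: "X \<in> cliques E V 2" "card (touch E V X) \<le> d" using B by auto
    obtain w where w: "X = {v, w}" using cliques_2E[OF X2(1)] X(2) by (metis insertE insert_commute singletonD)
    have ft: "finite (touch E V X)" using fin touch_subset finite_subset by (metis finite_Diff)
    have "{X \<in> B. v \<in> X} \<subseteq> (\<lambda>y. {v, y}) ` insert w (touch E V X)"
    proof
      fix Y assume Y: "Y \<in> {X \<in> B. v \<in> X}"
      then have Y2: "Y \<in> cliques E V 2" using B by auto
      obtain y where y: "Y = {v, y}" "v \<noteq> y" "y \<in> V" "{v, y} \<in> E"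
        using cliques_2E[OF Y2] Y by (smt (verit) doubleton_eq_iff insert_iff mem_Collect_eq singletonD)
      have "y = w \<or> y \<in> touch E V X" using y w unfolding touch_def by auto
      then show "Y \<in> (\<lambda>y. {v, y}) ` insert w (touch E V X)" using y by blast
    qed
    then have "card {X \<in> B. v \<in> X} \<le> card ((\<lambda>y. {v, y}) ` insert w (touch E V X))"
      using ft by (intro card_mono) auto
    also have "\<dots> \<le> card (insert w (touch E V X))" using ft by (intro card_image_le) simp
    also have "\<dots> \<le> Suc (card (touch E V X))" using ft by (simp add: card_insert_if)
    finally show ?thesis using X2 by simp
  next
    case True
    then show ?thesis by (metis card.empty le0)
  qed
  have "2 * card B = (\<Sum>X\<in>B. card X)"
    using B by (subst sum.cong[OF refl, of B card "\<lambda>_. 2"]) (auto simp: cliques_def ksets_def)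
  also have "\<dots> = (\<Sum>X\<in>B. \<Sum>v | v \<in> V \<and> v \<in> X. 1)"
  proof (intro sum.cong refl)
    fix X assume "X \<in> B"
    then have "X \<subseteq> V" using B by (auto simp: cliques_def ksets_def)
    then have "{v. v \<in> V \<and> v \<in> X} = X" by blast
    then show "card X = (\<Sum>v | v \<in> V \<and> v \<in> X. 1)" by simp
  qed
  also have "\<dots> = (\<Sum>v\<in>V. \<Sum>X | X \<in> B \<and> v \<in> X. 1)" by (rule sum.swap_restrict[OF fB fin])
  also have "\<dots> \<le> (\<Sum>v\<in>V. d + 1)" using deg by (intro sum_mono) simp
  finally show ?thesis by (simp add: mult.commute)
qed

section \<open>Isolated edges\<close>

text \<open>Linear combinations of \<open>clique_profile_eq\<close> with fixed \<open>t\<close>: a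
  polynomial of degree at most \<open>d\<close>, written in the binomial basis, times a binomial
  factor of degree \<open>t\<close>.\<close>

lemma clique_polynomial_eq:
  fixes c :: "nat \<Rightarrow> int"
  assumes fin: "finite V" "finite W" and card: "card V = card W" and deck: "deck k V E = deck k W F"
    and le: "f + d + t \<le> k" "k \<le> card V"
  shows "(\<Sum>X\<in>cliques E V f. (\<Sum>s\<le>d. c s * int (card (touch E V X) choose s)) *
      int ((card V - f - card (touch E V X)) choose t))
    = (\<Sum>X\<in>cliques F W f. (\<Sum>s\<le>d. c s * int (card (touch F W X) choose s)) *
      int ((card V - f - card (touch F W X)) choose t))"
proof -
  have swap: "(\<Sum>X\<in>A. (\<Sum>s\<le>d. c s * int (r X choose s)) * int ((card V - f - r X) choose t))
      = (\<Sum>s\<le>d. c s * int (\<Sum>X\<in>A. (r X choose s) * ((card V - f - r X) choose t)))"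
    for A :: "'z set set" and r
    by (simp add: sum_distrib_left sum_distrib_right mult.assoc sum.swap[of _ "{..d}" A])
  have "(\<Sum>X\<in>cliques E V f. (card (touch E V X) choose s) * ((card V - f - card (touch E V X)) choose t))
      = (\<Sum>X\<in>cliques F W f. (card (touch F W X) choose s) * ((card V - f - card (touch F W X)) choose t))"
    if "s \<le> d" for s
    using clique_profile_eq[OF fin card deck _ le(2), of f s t] that le by simp
  then show ?thesis unfolding swap by (intro sum.cong refl) simp
qed

lemma card_touch_le:
  assumes "finite V" "X \<in> cliques E V f"
  shows "card (touch E V X) \<le> card V - f"
proof -
  have X: "X \<subseteq> V" "card X = f" using assms by (auto simp: cliques_def ksets_def)
  have "card (touch E V X) \<le> card (V - X)" using assms touch_subset[of E V X] by (intro card_mono) simp_all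
  also have "\<dots> = card V - f" using X assms(1) finite_subset[OF X(1)] by (simp add: card_Diff_subset)
  finally show ?thesis .
qed

lemma int_choose_two: "2 * int (r choose 2) = int r * (int r - 1)"
  by (induction r) (simp_all add: numeral_2_eq_2 algebra_simps)

lemma int_binomial_absorb:
  "(int j + 1) * int ((m + (j + 1)) choose (j + 1)) = (int m + int j + 1) * int ((m + j) choose j)"
proof -
  have "(j + 1) * ((m + (j + 1)) choose (j + 1)) = (m + j + 1) * ((m + j) choose j)"
    using Suc_times_binomial_eq[of "m + j" j] by (simp add: mult.commute)
  then have "int ((j + 1) * ((m + (j + 1)) choose (j + 1))) = int ((m + j + 1) * ((m + j) choose j))"
    by (rule arg_cong)
  then show ?thesis by (simp only: of_nat_mult of_nat_add of_nat_1)
qed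

lemma int_choose_four:
  "24 * int ((m + 4) choose 4) = (int m + 4) * (int m + 3) * (int m + 2) * (int m + 1)"
proof -
  have "4 * int ((m + 4) choose 4) = (int m + 4) * int ((m + 3) choose 3)"
    using int_binomial_absorb[of 3 m] by simp
  moreover have "3 * int ((m + 3) choose 3) = (int m + 3) * int ((m + 2) choose 2)"
    using int_binomial_absorb[of 2 m] by simp
  moreover have "2 * int ((m + 2) choose 2) = (2 + int m) * (1 + int m)"
    using int_choose_two[of "m + 2"] by simp
  ultimately show ?thesis by algebra
qed

text \<open>As a polynomial in \<open>r\<close> this has degree \<open>n - 5\<close>, the largest degree of a statistic of edges that the
  \<open>(n - 3)\<close>-deck determines; for \<open>r \<le> n - 2\<close> it vanishes except at \<open>r = 0, 1, 4, 5\<close>.\<close>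
definition edge_weight :: "nat \<Rightarrow> nat \<Rightarrow> int" where
  "edge_weight n r = (int r - 2) * (int r - 3) * int ((n - 2 - r) choose (n - 7))"

lemma edge_weight_nonneg: "0 \<le> edge_weight n r"
proof -
  have "0 \<le> (int r - 2) * (int r - 3)" by (cases "r \<le> 2") (auto simp: mult_nonpos_nonpos)
  then show ?thesis by (simp add: edge_weight_def)
qed

lemma sum_edge_weight_eq:
  assumes fin: "finite V" "finite W" and card: "card V = card W" and n: "7 \<le> card V"
    and deck: "deck (card V - 3) V E = deck (card V - 3) W F"
  shows "(\<Sum>X\<in>cliques E V 2. edge_weight (card V) (card (touch E V X)))
    = (\<Sum>X\<in>cliques F W 2. edge_weight (card V) (card (touch F W X)))"
proof -
  \<comment> \<open>The expansion of \<open>(r - 2) (r - 3) = r^2 - 5 r + 6\<close> in binomials: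
    \<open>6 - 4 r + 2 (r choose 2)\<close>.\<close>
  define c :: "nat \<Rightarrow> int" where "c s = (if s = 0 then 6 else if s = 1 then -4 else 2)" for s
  have "{..2::nat} = {0, 1, 2}" by auto
  then have "(\<Sum>s\<le>2. c s * int (r choose s)) = (int r - 2) * (int r - 3)" for r
    using int_choose_two[of r] by (simp add: c_def algebra_simps)
  then show ?thesis
    using clique_polynomial_eq[OF fin card deck, of 2 2 "card V - 7" c] n
    by (simp add: edge_weight_def numeral_2_eq_2[symmetric])
qed

text \<open>The nonzero weights with \<open>r \<ge> 1\<close> are
  \<open>2 ((n - 3) choose 4)\<close> at \<open>r = 1\<close>, \<open>2 (n - 6)\<close> at
  \<open>r = 4\<close> and \<open>6\<close> at \<open>r = 5\<close>; the last two are covered by one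
  maximum.\<close>

lemma edge_weight_le:
  assumes "7 \<le> n" "1 \<le> r" "r \<le> n - 2"
  shows "edge_weight n r \<le> (if r = 1 then 2 * int ((n - 3) choose 4) else 0)
    + (if r = 4 \<or> r = 5 then max (2 * int n - 12) 6 else 0)"
proof -
  consider "r = 1" | "r = 2" | "r = 3" | "r = 4" | "r = 5" | "6 \<le> r" using assms by linarith
  then show ?thesis
  proof cases
    case 1
    have "(n - 3) choose (n - 7) = (n - 3) choose 4"
      using binomial_symmetric[of "n - 7" "n - 3"] assms(1) by (simp add: diff_diff_right)
    then show ?thesis using 1 by (simp add: edge_weight_def)
  next
    case 4
    have "(n - 6) choose (n - 7) = n - 6"
      using binomial_symmetric[of "n - 7" "n - 6"] assms(1) by simp
    then show ?thesis using 4 assms(1) by (simp add: edge_weight_def of_nat_diff)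
  next
    case 5
    then show ?thesis by (simp add: edge_weight_def)
  next
    case 6
    then have "n - 2 - r < n - 7" using assms by linarith
    then show ?thesis using 6 by (simp add: edge_weight_def binomial_eq_0)
  qed (simp_all add: edge_weight_def)
qed

text \<open>In a connected graph on at least seven vertices only these and the pendant edges have
  nonzero weight.\<close>

definition wide_edges :: "'a set set \<Rightarrow> 'a set \<Rightarrow> 'a set set" where
  "wide_edges E V = {X \<in> cliques E V 2. card (touch E V X) = 4 \<or> card (touch E V X) = 5}"

text \<open>The isolated edge alone contributes \<open>6 ((n - 2) choose 5)\<close> to the weight of
  the disconnected graph and nothing there is negative. The connected graph has the same total
  weight, carried by its pendant and wide edges only.\<close>

lemma pendant_wide_edges_bound:
  assumes fin: "finite V" "finite W" and card: "card V = card W" and n: "7 \<le> card V"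
    and deck: "deck (card V - 3) V E = deck (card V - 3) W F"
    and con: "conn E V" and X0: "X0 \<in> cliques F W 2" "touch F W X0 = {}"
  shows "6 * int ((card V - 2) choose 5) \<le> 2 * int ((card V - 3) choose 4) * int (card (pendant_edges E V))
    + max (2 * int (card V) - 12) 6 * int (card (wide_edges E V))"
proof -
  let ?n = "card V"
  let ?r = "\<lambda>X. card (touch E V X)"
  have fc: "finite (cliques E V 2)" "finite (cliques F W 2)" using fin by (auto simp: finite_cliques)
  have "(?n - 2) choose (?n - 7) = (?n - 2) choose 5"
  proof -
    have "?n - 2 - (?n - 7) = 5" using n by simp
    then show ?thesis using binomial_symmetric[of "?n - 7" "?n - 2"] by simp
  qed
  then have "6 * int ((?n - 2) choose 5) = edge_weight ?n (card (touch F W X0))"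
    using X0 by (simp add: edge_weight_def)
  also have "\<dots> \<le> (\<Sum>X\<in>cliques F W 2. edge_weight ?n (card (touch F W X)))"
    by (rule member_le_sum[OF X0(1) edge_weight_nonneg fc(2)])
  also have "\<dots> = (\<Sum>X\<in>cliques E V 2. edge_weight ?n (?r X))"
    using sum_edge_weight_eq[OF fin card n deck] by simp
  also have "\<dots> \<le> (\<Sum>X\<in>cliques E V 2. (if ?r X = 1 then 2 * int ((?n - 3) choose 4) else 0)
      + (if ?r X = 4 \<or> ?r X = 5 then max (2 * int ?n - 12) 6 else 0))"
  proof (intro sum_mono edge_weight_le n)
    fix X assume X: "X \<in> cliques E V 2"
    then have XV: "X \<subseteq> V" "card X = 2" by (auto simp: cliques_def ksets_def)
    then have "X \<noteq> {}" "X \<noteq> V" using n by auto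
    then have "touch E V X \<noteq> {}" by (rule conn_touch_nonempty[OF con XV(1)])
    moreover have "finite (touch E V X)" using fin(1) touch_subset[of E V X] finite_subset by blast
    ultimately show "1 \<le> ?r X" by (simp add: Suc_le_eq card_gt_0_iff)
    show "?r X \<le> ?n - 2" by (rule card_touch_le[OF fin(1) X])
  qed
  also have "\<dots> = 2 * int ((?n - 3) choose 4) * int (card (pendant_edges E V))
      + max (2 * int ?n - 12) 6 * int (card (wide_edges E V))"
    using fc by (simp add: sum.distrib sum.If_cases pendant_edges_def wide_edges_def Int_def)
  finally show ?thesis .
qed

text \<open>The case of at least 11 vertices, with \<open>n = m + 7\<close>,
  \<open>q = (n - 3) choose 4\<close>, \<open>q' = (n - 2) choose 5\<close>, \<open>k\<close>
  pendant and \<open>b\<close> wide edges. As \<open>k\<close> is only of order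
  \<open>sqrt n\<close> and \<open>b\<close> linear in \<open>n\<close>, the left side of
  \<open>le\<close> dominates.\<close>

lemma isolated_edge_arith:
  fixes m k b :: int
  assumes m: "4 \<le> m" and q: "24 * q = (m + 4) * (m + 3) * (m + 2) * (m + 1)" and q5: "5 * q' = (m + 5) * q"
    and k: "k * (k - 1) \<le> m + 5" and b: "b \<le> 3 * (m + 7)"
    and le: "6 * q' \<le> 2 * q * k + (2 * (m + 7) - 12) * b"
  shows False
proof -
  have "(2 * (m + 7) - 12) * b \<le> (2 * (m + 1)) * (3 * (m + 7))"
    using mult_left_mono[OF b, of "2 * (m + 1)"] m by (simp add: algebra_simps)
  then have "6 * ((m + 5) * q) \<le> 10 * q * k + 30 * ((m + 1) * (m + 7))" using le q5 by (simp add: algebra_simps)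
  then have "q * (6 * (m + 5) - 10 * k) \<le> 30 * ((m + 1) * (m + 7))" by (simp add: algebra_simps)
  \<comment> \<open>Multiplying by 24 allows \<open>q\<close> to be replaced by its product form;
    then \<open>2 (m + 1)\<close> cancels on both sides.\<close>
  then have "(24 * q) * (6 * (m + 5) - 10 * k) \<le> 720 * ((m + 1) * (m + 7))" by simp
  then have "(2 * (m + 1)) * ((m + 4) * (m + 3) * (m + 2) * (3 * (m + 5) - 5 * k)) \<le> (2 * (m + 1)) * (360 * (m + 7))"
    unfolding q by (simp add: algebra_simps)
  then have main: "(m + 4) * (m + 3) * (m + 2) * (3 * (m + 5) - 5 * k) \<le> 360 * (m + 7)"
    using m by (simp add: mult_le_cancel_left)
  show False
  proof (cases "m = 4")
    \<comment> \<open>At \<open>m = 4\<close> the margin is small: with \<open>k \<le> 3\<close> the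
      left side of \<open>main\<close> is at least \<open>336 * 12 = 4032\<close>, against
      \<open>360 * 11 = 3960\<close>.\<close>
    case True
    have "k \<le> 3"
    proof (rule ccontr)
      assume "\<not> k \<le> 3"
      then have "4 * 3 \<le> k * (k - 1)" by (intro mult_mono) auto
      then show False using k True by simp
    qed
    then show False using main True by simp
  next
    case False
    \<comment> \<open>A product of consecutive integers is nonnegative; this turns the quadratic
      bound on \<open>k\<close> into the linear one \<open>6 k \<le> m + 17\<close>. Below, 504 is
      the value of the cubic factor at \<open>m = 5\<close>.\<close>
    have "0 \<le> (k - 3) * (k - 4)" by (cases "k \<le> 3") (auto simp: mult_nonpos_nonpos)
    then have "6 * k \<le> m + 17" using k by (simp add: algebra_simps)
    then have k6: "13 * m + 5 \<le> 6 * (3 * (m + 5) - 5 * k)" by simp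
    have "9 * 8 * 7 \<le> (m + 4) * (m + 3) * (m + 2)" using m False by (intro mult_mono) auto
    then have "504 * (13 * m + 5) \<le> (m + 4) * (m + 3) * (m + 2) * (6 * (3 * (m + 5) - 5 * k))"
      using k6 m by (intro mult_mono) auto
    also have "\<dots> = 6 * ((m + 4) * (m + 3) * (m + 2) * (3 * (m + 5) - 5 * k))" by simp
    also have "\<dots> \<le> 6 * (360 * (m + 7))" using main by simp
    finally show False using m False by simp
  qed
qed

text \<open>At most \<open>n - 2\<close> connected cards leave room for few pendant edges, since
  \<open>k (k - 1) \<le> n - 2\<close>. Wide edges are impossible for \<open>n \<le> 9\<close>, at
  most 10 for \<open>n = 10\<close> and at most \<open>3 n\<close> beyond, so the weight bound
  cannot be met.\<close>

lemma no_isolated_edge: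
  assumes fin: "finite V" "finite W" and card: "card V = card W" and n: "7 \<le> card V"
    and deck: "deck (card V - 3) V E = deck (card V - 3) W F"
    and con: "conn E V" and X0: "X0 \<in> cliques F W 2" "touch F W X0 = {}"
    and few: "card (conn_sets F W (card V - 3)) \<le> card V - 2"
  shows False
proof -
  let ?n = "card V" and ?k = "card (pendant_edges E V)" and ?B = "wide_edges E V"
  let ?c = "card (conn_sets E V (?n - 3))"
  have c: "?c \<le> ?n - 2" using card_conn_sets_eq[OF fin deck] few by simp
  have k: "?k * (?k - 1) \<le> ?n - 2" using pendant_edges_conn_sets[OF con fin(1)] n c by simp
  note bound = pendant_wide_edges_bound[OF fin card n deck con X0]
  have XV: "X \<subseteq> V" "card X = 2" "conn E X" if X: "X \<in> ?B" for X
  proof -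
    have X2: "X \<in> cliques E V 2" using X by (simp add: wide_edges_def)
    then show "X \<subseteq> V" "card X = 2" by (auto simp: cliques_def ksets_def)
    obtain u v where "X = {u, v}" "{u, v} \<in> E" using cliques_2E[OF X2] by metis
    then show "conn E X" using conn_insert[OF conn_singleton[of E u], of u v] by (simp add: insert_commute)
  qed
  have over_le: "card (conn_sets_over E X V (?n - 3)) \<le> ?c" for X
    using fin(1) by (intro card_mono finite_conn_sets) (auto simp: conn_sets_over_def)
  have six: "6 \<le> card (conn_sets_over E X V 4)" if "X \<in> ?B" for X
    using card_conn_sets_over_pairs[OF XV(3)[OF that] XV(1)[OF that] fin(1)] XV(2)[OF that] that
    by (auto simp: wide_edges_def)
  have eight: "8 \<le> card (conn_sets_over E X V (?n - 3))" if "X \<in> ?B" "8 \<le> ?n" for X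
    using card_conn_sets_over_ge_8[OF con fin(1) XV(3)[OF that(1)] XV(1)[OF that(1)]] XV(2)[OF that(1)] that
    by (auto simp: wide_edges_def)
  have kge: "j * (j - 1) \<le> ?n - 2" if "j \<le> ?k" for j
    using mult_le_mono[OF that, of "j - 1" "?k - 1"] that k by (meson diff_le_mono le_trans)
  \<comment> \<open>One wide edge already gives too many connected cards: 8 against 6 or 7 for
    \<open>n = 8, 9\<close>, and 6 against 5 for \<open>n = 7\<close>.\<close>
  have B0: "?B = {}" if "?n \<le> 9"
  proof (rule ccontr)
    assume "?B \<noteq> {}"
    then obtain X where X: "X \<in> ?B" by blast
    show False
    proof (cases "?n = 7")
      case True
      then show False using six[OF X] over_le[of X] c by simp
    next
      case False
      then show False using eight[OF X] over_le[of X] c that n by simp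
    qed
  qed
  \<comment> \<open>For \<open>n = 7, 8, 9\<close> the bound reads \<open>6 \<le> 2 k\<close>,
    \<open>36 \<le> 10 k\<close>, \<open>126 \<le> 30 k\<close>, so \<open>k\<close> is at least 3,
    4, 5, and \<open>k (k - 1)\<close> exceeds \<open>n - 2\<close>.\<close>
  consider "?n = 7" | "?n = 8" | "?n = 9" | "?n = 10" | "11 \<le> ?n" using n by linarith
  then show False
  proof cases
    case 1
    then have "3 \<le> ?k" using bound B0 by simp
    then show False using kge[of 3] 1 by simp
  next
    case 2
    then have "4 \<le> ?k" using bound B0 by (simp add: numeral_eq_Suc)
    then show False using kge[of 4] 2 by simp
  next
    case 3
    then have "5 \<le> ?k" using bound B0 by (simp add: numeral_eq_Suc)
    then show False using kge[of 5] 3 by simp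
  next
    case 4
    \<comment> \<open>There are at most 8 connected cards and each wide edge lies in at least 8, so
      every connected card contains every wide edge.\<close>
    have "card ?B \<le> 10"
    proof (cases "?B = {}")
      case False
      let ?U = "\<Union>?B"
      have UV: "?U \<subseteq> V" using XV by blast
      have fU: "finite ?U" using UV fin(1) finite_subset by blast
      have all: "conn_sets_over E X V 7 = conn_sets E V 7" if "X \<in> ?B" for X
      proof (rule card_subset_eq)
        show "finite (conn_sets E V 7)" using fin(1) by (rule finite_conn_sets)
        show "conn_sets_over E X V 7 \<subseteq> conn_sets E V 7" by (auto simp: conn_sets_over_def)
        show "card (conn_sets_over E X V 7) = card (conn_sets E V 7)"
          using eight[OF that] over_le[of X] c 4 by simp
      qed
      then have sub: "conn_sets E V 7 \<subseteq> {S \<in> ksets V 7. ?U \<subseteq> S}"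
        unfolding conn_sets_over_def conn_sets_def by blast
      obtain X where X: "X \<in> ?B" using False by blast
      have "8 \<le> card (conn_sets E V 7)" using eight[OF X] all[OF X] 4 by simp
      also have "\<dots> \<le> card {S \<in> ksets V 7. ?U \<subseteq> S}"
        using fin(1) sub by (intro card_mono) (auto simp: finite_ksets)
      finally have ge8: "8 \<le> card {S \<in> ksets V 7. ?U \<subseteq> S}" .
      \<comment> \<open>Among 10 vertices only 4 sets of size 7 contain a given set of size 6, and
        only one contains a given set of size 7. So the wide edges live on at most 5
        vertices.\<close>
      have U5: "card ?U \<le> 5"
      proof (rule ccontr)
        assume U6: "\<not> card ?U \<le> 5"
        have "{S \<in> ksets V 7. ?U \<subseteq> S} \<noteq> {}" using ge8 by force
        then obtain S where "S \<in> ksets V 7" "?U \<subseteq> S" by blast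
        then have U7: "card ?U \<le> 7"
          using card_mono[of S ?U] fin(1) finite_subset[of S V] by (auto simp: ksets_def)
        then have "card {S \<in> ksets V 7. ?U \<subseteq> S} = (10 - card ?U) choose (7 - card ?U)"
          using card_supersets[OF fin(1) UV, of 7] 4 by simp
        moreover have "card ?U = 6 \<or> card ?U = 7" using U6 U7 by linarith
        ultimately show False using ge8 by (auto simp: numeral_eq_Suc)
      qed
      have "?B \<subseteq> ksets ?U 2" using XV by (auto simp: ksets_def)
      then have "card ?B \<le> card (ksets ?U 2)" using fU by (intro card_mono finite_ksets)
      also have "\<dots> = card ?U choose 2" using n_subsets[OF fU] by (simp add: ksets_def)
      also have "\<dots> \<le> 5 choose 2" using U5 by (rule binomial_right_mono)
      also have "\<dots> = 10" by (simp add: numeral_eq_Suc)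
      finally show ?thesis .
    qed simp
    \<comment> \<open>The weight bound is now \<open>336 \<le> 70 k + 80\<close>, so
      \<open>k \<ge> 4\<close>, although \<open>k (k - 1) \<le> 8\<close>.\<close>
    then have "8 * int (card ?B) \<le> 80" by simp
    moreover have "(8::nat) choose 5 = 56" "(7::nat) choose 4 = 35" by (simp_all add: numeral_eq_Suc)
    ultimately have "4 \<le> ?k" using bound 4 by simp
    then show False using kge[of 4] 4 by simp
  next
    case 5
    have "2 * card ?B \<le> (5 + 1) * ?n"
      by (rule card_edges_small_touch[OF fin(1)]) (auto simp: wide_edges_def)
    then have b: "int (card ?B) \<le> 3 * (int (?n - 7) + 7)" using n by simp
    obtain m where m: "?n = m + 7" using n by (metis add.commute le_Suc_ex)
    have q5: "5 * int ((m + 5) choose 5) = (int m + 5) * int ((m + 4) choose 4)"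
      using int_binomial_absorb[of 4 m] by simp
    have k': "int ?k * (int ?k - 1) \<le> int m + 5"
    proof -
      have "int (?k * (?k - 1)) \<le> int (m + 5)" using k m by (simp only: of_nat_le_iff)
      then show ?thesis by (cases ?k) (simp_all add: algebra_simps)
    qed
    have le: "6 * int ((m + 5) choose 5) \<le> 2 * int ((m + 4) choose 4) * int ?k + (2 * (int m + 7) - 12) * int (card ?B)"
    proof -
      have "?n - 2 = m + 5" "?n - 3 = m + 4" "int ?n = int m + 7" using m by simp_all
      then show ?thesis using bound 5 by (simp add: max_def)
    qed
    show False
      by (rule isolated_edge_arith[OF _ int_choose_four q5 k' _ le]) (use b m 5 in auto)
  qed
qed

section \<open>Isolated vertices\<close>

lemma int_choose_three: "6 * int (r choose 3) = int r * (int r - 1) * (int r - 2)"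
proof (induction r)
  case (Suc r)
  have "Suc r choose 3 = (r choose 2) + (r choose 3)" by (simp add: numeral_3_eq_3 numeral_2_eq_2)
  then have "6 * int (Suc r choose 3) = 3 * (2 * int (r choose 2)) + 6 * int (r choose 3)" by simp
  also have "\<dots> = 3 * (int r * (int r - 1)) + int r * (int r - 1) * (int r - 2)"
    using Suc int_choose_two[of r] by simp
  finally show ?case by (simp add: algebra_simps)
qed simp

lemma cliques_1: "cliques E V 1 = (\<lambda>v. {v}) ` V"
  by (auto simp: cliques_def ksets_def card_1_singleton_iff)

lemma card_cliques_1: "card (cliques E V 1) = card V"
  unfolding cliques_1 by (simp add: card_image)

text \<open>For \<open>r \<le> n - 1\<close> this vanishes except at \<open>r = 0, 2, 5, 6\<close>, and it is negative only at \<open>r = 0\<close>.\<close>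
definition vertex_weight :: "nat \<Rightarrow> nat \<Rightarrow> int" where
  "vertex_weight n r = (int r - 1) * (int r - 3) * (int r - 4) * int ((n - 1 - r) choose (n - 7))"

lemma sum_vertex_weight_eq:
  assumes fin: "finite V" "finite W" and card: "card V = card W" and n: "7 \<le> card V"
    and deck: "deck (card V - 3) V E = deck (card V - 3) W F"
  shows "(\<Sum>X\<in>cliques E V 1. vertex_weight (card V) (card (touch E V X)))
    = (\<Sum>X\<in>cliques F W 1. vertex_weight (card V) (card (touch F W X)))"
proof -
  \<comment> \<open>The expansion of
    \<open>(r - 1) (r - 3) (r - 4) = r^3 - 8 r^2 + 19 r - 12\<close> in binomials.\<close>
  define c :: "nat \<Rightarrow> int" where "c s = (if s = 0 then -12 else if s = 1 then 12 else if s = 2 then -10 else 6)" for s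
  have "{..3::nat} = {0, 1, 2, 3}" by auto
  then have "(\<Sum>s\<le>3. c s * int (r choose s)) = -12 + 12 * int r - 5 * (2 * int (r choose 2)) + 6 * int (r choose 3)" for r
    by (simp add: c_def)
  then have "(\<Sum>s\<le>3. c s * int (r choose s)) = (int r - 1) * (int r - 3) * (int r - 4)" for r
    unfolding int_choose_two int_choose_three by (simp add: algebra_simps)
  then show ?thesis
    using clique_polynomial_eq[OF fin card deck, of 1 3 "card V - 7" c] n
    by (simp add: vertex_weight_def)
qed

lemma vertex_weight_nonneg: "1 \<le> r \<Longrightarrow> 0 \<le> vertex_weight n r"
proof -
  assume "1 \<le> r"
  moreover have "0 \<le> (int r - 3) * (int r - 4)" by (cases "r \<le> 3") (auto simp: mult_nonpos_nonpos)
  ultimately have "0 \<le> (int r - 1) * ((int r - 3) * (int r - 4))" by simp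
  then show ?thesis unfolding vertex_weight_def by (metis mult.assoc of_nat_0_le_iff zero_le_mult_iff)
qed

text \<open>The bound is the value at \<open>r = 2\<close>. The competitors are
  \<open>8 (n - 6)\<close> at \<open>r = 5\<close> and \<open>30\<close> at \<open>r = 6\<close>;
  for \<open>n = 9\<close> the latter equals the bound.\<close>

lemma vertex_weight_le:
  assumes n: "9 \<le> n" and r: "r \<le> n - 1"
  shows "vertex_weight n r \<le> 2 * int ((n - 3) choose 4)"
proof -
  obtain m where m: "n = m + 7" "2 \<le> m" using n that[of "n - 7"] by simp
  have "6 * 5 * 4 \<le> (int m + 4) * (int m + 3) * (int m + 2)" using m by (intro mult_mono) auto
  then have "120 * (int m + 1) \<le> (int m + 4) * (int m + 3) * (int m + 2) * (int m + 1)"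
    by (intro mult_right_mono) auto
  then have q5: "5 * (int m + 1) \<le> int ((m + 4) choose 4)" using int_choose_four[of m] by linarith
  have nn: "n - 3 = m + 4" "n - 7 = m" "n - 1 - 2 = m + 4" "n - 1 - 5 = m + 1" "n - 1 - 6 = m"
    using m by simp_all
  consider "r = 0" | "r = 1" | "r = 2" | "r = 3" | "r = 4" | "r = 5" | "r = 6" | "7 \<le> r" by linarith
  then show ?thesis
  proof cases
    case 3
    have "(m + 4) choose m = (m + 4) choose 4" using binomial_symmetric[of m "m + 4"] by simp
    then show ?thesis using 3 nn by (simp add: vertex_weight_def)
  next
    case 6
    then show ?thesis using nn q5 by (simp add: vertex_weight_def)
  next
    case 7
    have "15 \<le> int ((m + 4) choose 4)" using q5 of_nat_mono[OF m(2), where 'a = int] by simp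
    then show ?thesis using 7 nn by (simp add: vertex_weight_def)
  next
    case 8
    then have "n - 1 - r < n - 7" using r n by linarith
    then show ?thesis by (simp add: vertex_weight_def binomial_eq_0)
  qed (simp_all add: vertex_weight_def)
qed

text \<open>Without isolated vertices the total vertex weight is nonnegative. An isolated vertex
  contributes \<open>- 12 ((n - 1) choose 6)\<close>, which the other \<open>n - 1\<close> vertices
  cannot compensate with at most \<open>2 ((n - 3) choose 4)\<close> each.\<close>

lemma no_isolated_vertex_ge_9:
  assumes fin: "finite V" "finite W" and card: "card V = card W" and n: "9 \<le> card V"
    and deck: "deck (card V - 3) V E = deck (card V - 3) W F"
    and G: "\<And>X. X \<in> cliques E V 1 \<Longrightarrow> touch E V X \<noteq> {}"
    and v: "Y0 \<in> cliques F W 1" "touch F W Y0 = {}"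
  shows False
proof -
  let ?n = "card V"
  have fc: "finite (cliques F W 1)" using fin by (simp add: finite_cliques)
  have "0 \<le> (\<Sum>X\<in>cliques E V 1. vertex_weight ?n (card (touch E V X)))"
  proof (intro sum_nonneg vertex_weight_nonneg)
    fix X assume "X \<in> cliques E V 1"
    moreover have "finite (touch E V X)" using fin(1) touch_subset[of E V X] finite_subset by blast
    ultimately show "1 \<le> card (touch E V X)" using G by (simp add: Suc_le_eq card_gt_0_iff)
  qed
  also have "\<dots> = (\<Sum>X\<in>cliques F W 1. vertex_weight ?n (card (touch F W X)))"
    using sum_vertex_weight_eq[OF fin card _ deck] n by simp
  also have "\<dots> = vertex_weight ?n 0 + (\<Sum>X\<in>cliques F W 1 - {Y0}. vertex_weight ?n (card (touch F W X)))"
    using sum.remove[OF fc v(1), of "\<lambda>X. vertex_weight ?n (card (touch F W X))"] v(2) by simp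
  also have "\<dots> \<le> vertex_weight ?n 0 + (\<Sum>X\<in>cliques F W 1 - {Y0}. 2 * int ((?n - 3) choose 4))"
    using card_touch_le[OF fin(2), of _ F 1] card
    by (intro add_left_mono sum_mono vertex_weight_le n) auto
  also have "\<dots> = vertex_weight ?n 0 + int (?n - 1) * (2 * int ((?n - 3) choose 4))"
    using card_Diff_singleton[OF v(1)] card_cliques_1[of F W] card by simp
  finally have le: "0 \<le> vertex_weight ?n 0 + int (?n - 1) * (2 * int ((?n - 3) choose 4))" .
  obtain m where m: "?n = m + 7" "2 \<le> m"
    using n that[of "?n - 7"] by simp
  have "(m + 6) choose m = (m + 6) choose 6" using binomial_symmetric[of m "m + 6"] by simp
  moreover have "?n - 1 - 0 = m + 6" "?n - 7 = m" "?n - 3 = m + 4" "int (?n - 1) = int m + 6" using m by simp_all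
  ultimately have w: "vertex_weight ?n 0 = - 12 * int ((m + 6) choose 6)"
    and le': "0 \<le> vertex_weight ?n 0 + (int m + 6) * (2 * int ((m + 4) choose 4))"
    using le by (simp_all add: vertex_weight_def)
  \<comment> \<open>Absorption gives
    \<open>30 ((m + 6) choose 6) = (m + 6) (m + 5) ((m + 4) choose 4)\<close>, so the negative term
    wins by the factor \<open>(m + 5) / 5\<close>.\<close>
  have "6 * int ((m + 6) choose 6) = (int m + 6) * int ((m + 5) choose 5)"
    using int_binomial_absorb[of 5 m] by simp
  moreover have "5 * int ((m + 5) choose 5) = (int m + 5) * int ((m + 4) choose 4)"
    using int_binomial_absorb[of 4 m] by simp
  ultimately have "30 * int ((m + 6) choose 6) = (int m + 6) * ((int m + 5) * int ((m + 4) choose 4))" by algebra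
  moreover have "0 < (m + 4) choose 4" by simp
  ultimately have "(int m + 6) * (5 * int ((m + 4) choose 4)) < 30 * int ((m + 6) choose 6)"
    using m by (simp add: mult_strict_left_mono mult_strict_right_mono)
  then show False using le' w by linarith
qed

section \<open>Degree counts for eight and seven vertices\<close>

definition deg_set :: "'a set set \<Rightarrow> 'a set \<Rightarrow> nat \<Rightarrow> 'a set" where
  "deg_set E V i = {v \<in> V. card (touch E V {v}) = i}"

lemma finite_deg_set: "finite V \<Longrightarrow> finite (deg_set E V i)"
  by (simp add: deg_set_def)

lemma card_touch_vertex_less:
  assumes "finite V" "v \<in> V"
  shows "card (touch E V {v}) < card V"
  using assms by (intro psubset_card_mono) (auto simp: touch_def)

lemma sum_cliques_1_deg_set:
  fixes g :: "nat \<Rightarrow> nat"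
  assumes "finite V"
  shows "(\<Sum>X\<in>cliques E V 1. g (card (touch E V X))) = (\<Sum>i<card V. card (deg_set E V i) * g i)"
proof -
  have "(\<Sum>X\<in>cliques E V 1. g (card (touch E V X))) = (\<Sum>v\<in>V. g (card (touch E V {v})))"
    unfolding cliques_1 by (subst sum.reindex) simp_all
  also have "\<dots> = (\<Sum>i<card V. \<Sum>v | v \<in> V \<and> card (touch E V {v}) = i. g (card (touch E V {v})))"
    by (rule sum.group[symmetric]) (use assms card_touch_vertex_less[OF assms] in auto)
  also have "\<dots> = (\<Sum>i<card V. card (deg_set E V i) * g i)"
    by (intro sum.cong refl) (simp add: deg_set_def)
  finally show ?thesis .
qed

text \<open>The case \<open>f = 1\<close>, \<open>t = 0\<close> of the clique profile: the deck
  determines the binomial moments of the degree sequence up to order \<open>n - 4\<close>.\<close>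

lemma degree_moment_eq:
  assumes fin: "finite V" "finite W" and card: "card V = card W" and n: "4 \<le> card V"
    and deck: "deck (card V - 3) V E = deck (card V - 3) W F" and s: "s \<le> card V - 4"
  shows "(\<Sum>i<card V. card (deg_set E V i) * (i choose s)) = (\<Sum>i<card V. card (deg_set F W i) * (i choose s))"
proof -
  have "(\<Sum>X\<in>cliques E V 1. card (touch E V X) choose s) = (\<Sum>X\<in>cliques F W 1. card (touch F W X) choose s)"
    using clique_profile_eq[OF fin card deck, of 1 s 0] n s by simp
  then show ?thesis
    using sum_cliques_1_deg_set[OF fin(1), of "\<lambda>r. r choose s" E]
      sum_cliques_1_deg_set[OF fin(2), of "\<lambda>r. r choose s" F] card by simp
qed

lemma sum_card_deg_set:
  assumes "finite V"
  shows "(\<Sum>i<card V. card (deg_set E V i)) = card V"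
  using sum_cliques_1_deg_set[OF assms, of "\<lambda>_. 1" E] card_cliques_1[of E V] by simp

lemma touch_vertex_sym: "u \<in> V \<Longrightarrow> v \<in> V \<Longrightarrow> u \<in> touch E V {v} \<longleftrightarrow> v \<in> touch E V {u}"
  by (auto simp: touch_def insert_commute)

lemma deg_set_full_empty:
  assumes fin: "finite W" and v: "v \<in> W" "touch F W {v} = {}" and n: "2 \<le> card W"
  shows "deg_set F W (card W - 1) = {}"
proof (rule ccontr)
  assume "deg_set F W (card W - 1) \<noteq> {}"
  then obtain w where w: "w \<in> W" "card (touch F W {w}) = card W - 1" by (auto simp: deg_set_def)
  have "touch F W {w} = W - {w}"
    using fin w touch_subset[of F W "{w}"] by (intro card_subset_eq) auto
  moreover have "w \<noteq> v" using w v n by auto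
  ultimately have "v \<in> touch F W {w}" using v by blast
  then have "w \<in> touch F W {v}" using touch_vertex_sym w v by metis
  then show False using v by simp
qed

lemma small_binomials:
  "(4::nat) choose 3 = 4" "(5::nat) choose 3 = 10" "(6::nat) choose 3 = 20" "(7::nat) choose 3 = 35"
  "(5::nat) choose 4 = 5" "(6::nat) choose 4 = 15" "(7::nat) choose 4 = 35"
  by (simp_all add: numeral_eq_Suc)

text \<open>\<open>a\<close> and \<open>b\<close> with index \<open>i\<close> stand for the numbers
  of vertices of degree \<open>i\<close> in the two graphs. The equations are the moments of orders
  0 to 4, with no vertex of degree 0 in the first graph and none of degree 7 in the second, which
  has an isolated vertex.\<close>

lemma degrees_8_infeasible:
  fixes a1 a2 a3 a4 a5 a6 a7 b0 b1 b2 b3 b4 b5 b6 :: int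
  assumes "0 \<le> a1" "0 \<le> a2" "0 \<le> a3" "0 \<le> a4" "0 \<le> a5" "0 \<le> a6" "0 \<le> a7"
    and "1 \<le> b0" "0 \<le> b1" "0 \<le> b2" "0 \<le> b3" "0 \<le> b4" "0 \<le> b5" "0 \<le> b6"
    and "a1 + a2 + a3 + a4 + a5 + a6 + a7 = 8" "b0 + b1 + b2 + b3 + b4 + b5 + b6 = 8"
    and "a1 + 2 * a2 + 3 * a3 + 4 * a4 + 5 * a5 + 6 * a6 + 7 * a7 = b1 + 2 * b2 + 3 * b3 + 4 * b4 + 5 * b5 + 6 * b6"
    and "a2 + 3 * a3 + 6 * a4 + 10 * a5 + 15 * a6 + 21 * a7 = b2 + 3 * b3 + 6 * b4 + 10 * b5 + 15 * b6"
    and "a3 + 4 * a4 + 10 * a5 + 20 * a6 + 35 * a7 = b3 + 4 * b4 + 10 * b5 + 20 * b6"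
    and "a4 + 5 * a5 + 15 * a6 + 35 * a7 = b4 + 5 * b5 + 15 * b6"
  shows False
  using assms by (smt (z3))

text \<open>Here only the moments of orders 0 to 3 are available. They leave exactly one difference
  of the degree counts, \<open>(-1, 3, -2, -2, 3, -1, 0)\<close> for degrees 0 to 6.\<close>

lemma degrees_7_unique:
  fixes a1 a2 a3 a4 a5 a6 b0 b1 b2 b3 b4 b5 :: int
  assumes "0 \<le> a1" "0 \<le> a2" "0 \<le> a3" "0 \<le> a4" "0 \<le> a5" "0 \<le> a6"
    and "1 \<le> b0" "0 \<le> b1" "0 \<le> b2" "0 \<le> b3" "0 \<le> b4" "0 \<le> b5"
    and "a1 + a2 + a3 + a4 + a5 + a6 = 7" "b0 + b1 + b2 + b3 + b4 + b5 = 7"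
    and "a1 + 2 * a2 + 3 * a3 + 4 * a4 + 5 * a5 + 6 * a6 = b1 + 2 * b2 + 3 * b3 + 4 * b4 + 5 * b5"
    and "a2 + 3 * a3 + 6 * a4 + 10 * a5 + 15 * a6 = b2 + 3 * b3 + 6 * b4 + 10 * b5"
    and "a3 + 4 * a4 + 10 * a5 + 20 * a6 = b3 + 4 * b4 + 10 * b5"
  shows "b0 = 1 \<and> a1 = b1 + 3 \<and> b2 = a2 + 2 \<and> b3 = a3 + 2 \<and> a4 = b4 + 3 \<and> b5 = a5 + 1 \<and> a6 = 0"
  using assms by (smt (z3))

lemma no_isolated_vertex_8:
  assumes fin: "finite V" "finite W" and card: "card V = 8" "card W = 8"
    and deck: "deck 5 V E = deck 5 W F"
    and G: "deg_set E V 0 = {}"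
    and v: "v \<in> W" "touch F W {v} = {}"
  shows False
proof -
  define a where "a i = int (card (deg_set E V i))" for i
  define b where "b i = int (card (deg_set F W i))" for i
  have "v \<in> deg_set F W 0" using v by (simp add: deg_set_def)
  then have b0: "1 \<le> b 0" using finite_deg_set[OF fin(2), of F 0] card_gt_0_iff[of "deg_set F W 0"]
    by (auto simp: b_def)
  have a0: "a 0 = 0" using G by (simp add: a_def)
  have b7: "b 7 = 0" using deg_set_full_empty[OF fin(2) v] card by (simp add: b_def)
  have nn: "0 \<le> a i" "0 \<le> b i" for i by (simp_all add: a_def b_def)
  have S: "{..<8::nat} = {0, 1, 2, 3, 4, 5, 6, 7}" by auto
  have "int (\<Sum>i<8. card (deg_set E V i) * (i choose s)) = int (\<Sum>i<8. card (deg_set F W i) * (i choose s))"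
    if "s \<le> 4" for s
    using degree_moment_eq[OF fin, of E F s] card deck that by simp
  then have mom: "(\<Sum>i<8. a i * int (i choose s)) = (\<Sum>i<8. b i * int (i choose s))" if "s \<le> 4" for s
    using that by (simp add: a_def b_def)
  have sa: "(\<Sum>i<8. a i) = 8" and sb: "(\<Sum>i<8. b i) = 8"
    using sum_card_deg_set[OF fin(1), of E] sum_card_deg_set[OF fin(2), of F] card
    by (simp_all add: a_def b_def flip: of_nat_sum)
  show False
  proof (rule degrees_8_infeasible[of "a 1" "a 2" "a 3" "a 4" "a 5" "a 6" "a 7" "b 0" "b 1" "b 2" "b 3" "b 4" "b 5" "b 6"])
    show "a 1 + a 2 + a 3 + a 4 + a 5 + a 6 + a 7 = 8" using sa a0 unfolding S by simp
    show "b 0 + b 1 + b 2 + b 3 + b 4 + b 5 + b 6 = 8" using sb b7 unfolding S by simp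
    show "a 1 + 2 * a 2 + 3 * a 3 + 4 * a 4 + 5 * a 5 + 6 * a 6 + 7 * a 7
        = b 1 + 2 * b 2 + 3 * b 3 + 4 * b 4 + 5 * b 5 + 6 * b 6"
      using mom[of 1] b7 unfolding S by simp
    show "a 2 + 3 * a 3 + 6 * a 4 + 10 * a 5 + 15 * a 6 + 21 * a 7
        = b 2 + 3 * b 3 + 6 * b 4 + 10 * b 5 + 15 * b 6"
      using mom[of 2] b7 unfolding S by (simp add: choose_two)
    show "a 3 + 4 * a 4 + 10 * a 5 + 20 * a 6 + 35 * a 7 = b 3 + 4 * b 4 + 10 * b 5 + 20 * b 6"
      using mom[of 3] b7 unfolding S by (simp add: small_binomials binomial_eq_0)
    show "a 4 + 5 * a 5 + 15 * a 6 + 35 * a 7 = b 4 + 5 * b 5 + 15 * b 6"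
      using mom[of 4] b7 unfolding S by (simp add: small_binomials binomial_eq_0)
  qed (use nn b0 in auto)
qed

text \<open>For seven vertices the degree statistics alone do not exclude an isolated vertex; this one difference of
  degree lists survives. It is ruled out below by counting copies of \<open>K\<^sub>4\<close> and induced copies of \<open>2K\<^sub>2\<close>.\<close>
lemma no_isolated_vertex_7_degrees:
  assumes fin: "finite V" "finite W" and card: "card V = 7" "card W = 7"
    and deck: "deck 4 V E = deck 4 W F"
    and G: "deg_set E V 0 = {}"
    and v: "v \<in> W" "touch F W {v} = {}"
  shows "card (deg_set F W 0) = 1 \<and> card (deg_set E V 1) = card (deg_set F W 1) + 3
    \<and> card (deg_set F W 2) = card (deg_set E V 2) + 2 \<and> card (deg_set F W 3) = card (deg_set E V 3) + 2
    \<and> card (deg_set E V 4) = card (deg_set F W 4) + 3 \<and> card (deg_set F W 5) = card (deg_set E V 5) + 1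
    \<and> card (deg_set E V 6) = 0"
proof -
  define a where "a i = int (card (deg_set E V i))" for i
  define b where "b i = int (card (deg_set F W i))" for i
  have "v \<in> deg_set F W 0" using v by (simp add: deg_set_def)
  then have b0: "1 \<le> b 0" using finite_deg_set[OF fin(2), of F 0] card_gt_0_iff[of "deg_set F W 0"]
    by (auto simp: b_def)
  have a0: "a 0 = 0" using G by (simp add: a_def)
  have b6: "b 6 = 0" using deg_set_full_empty[OF fin(2) v] card by (simp add: b_def)
  have nn: "0 \<le> a i" "0 \<le> b i" for i by (simp_all add: a_def b_def)
  have S: "{..<7::nat} = {0, 1, 2, 3, 4, 5, 6}" by auto
  have "int (\<Sum>i<7. card (deg_set E V i) * (i choose s)) = int (\<Sum>i<7. card (deg_set F W i) * (i choose s))"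
    if "s \<le> 3" for s
    using degree_moment_eq[OF fin, of E F s] card deck that by simp
  then have mom: "(\<Sum>i<7. a i * int (i choose s)) = (\<Sum>i<7. b i * int (i choose s))" if "s \<le> 3" for s
    using that by (simp add: a_def b_def)
  have sa: "(\<Sum>i<7. a i) = 7" and sb: "(\<Sum>i<7. b i) = 7"
    using sum_card_deg_set[OF fin(1), of E] sum_card_deg_set[OF fin(2), of F] card
    by (simp_all add: a_def b_def flip: of_nat_sum)
  have "b 0 = 1 \<and> a 1 = b 1 + 3 \<and> b 2 = a 2 + 2 \<and> b 3 = a 3 + 2 \<and> a 4 = b 4 + 3 \<and> b 5 = a 5 + 1 \<and> a 6 = 0"
  proof (rule degrees_7_unique)
    show "a 1 + a 2 + a 3 + a 4 + a 5 + a 6 = 7" using sa a0 unfolding S by simp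
    show "b 0 + b 1 + b 2 + b 3 + b 4 + b 5 = 7" using sb b6 unfolding S by simp
    show "a 1 + 2 * a 2 + 3 * a 3 + 4 * a 4 + 5 * a 5 + 6 * a 6 = b 1 + 2 * b 2 + 3 * b 3 + 4 * b 4 + 5 * b 5"
      using mom[of 1] b6 unfolding S by simp
    show "a 2 + 3 * a 3 + 6 * a 4 + 10 * a 5 + 15 * a 6 = b 2 + 3 * b 3 + 6 * b 4 + 10 * b 5"
      using mom[of 2] b6 unfolding S by (simp add: choose_two)
    show "a 3 + 4 * a 4 + 10 * a 5 + 20 * a 6 = b 3 + 4 * b 4 + 10 * b 5"
      using mom[of 3] b6 unfolding S by (simp add: small_binomials binomial_eq_0)
  qed (use nn b0 in auto)
  then show ?thesis unfolding a_def b_def by linarith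
qed

section \<open>Seven vertices: copies of \<open>K4\<close> and induced copies of
  \<open>2K2\<close>\<close>

definition has_2K2 :: "'a set set \<Rightarrow> 'a set \<Rightarrow> bool" where
  "has_2K2 E S \<longleftrightarrow> (\<exists>a\<in>S. \<exists>b\<in>S. \<exists>c\<in>S. \<exists>d\<in>S. a \<noteq> b \<and> c \<noteq> d \<and> {a, b} \<inter> {c, d} = {} \<and> {a, b} \<in> E \<and> {c, d} \<in> E
    \<and> {a, c} \<notin> E \<and> {a, d} \<notin> E \<and> {b, c} \<notin> E \<and> {b, d} \<notin> E)"

lemma has_2K2_iso:
  assumes "iso_between g E S F T" "has_2K2 E S"
  shows "has_2K2 F T"
proof -
  obtain a b c d where S: "a \<in> S" "b \<in> S" "c \<in> S" "d \<in> S"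
    and ne: "a \<noteq> b" "c \<noteq> d" "{a, b} \<inter> {c, d} = {}"
    and e: "{a, b} \<in> E" "{c, d} \<in> E" "{a, c} \<notin> E" "{a, d} \<notin> E" "{b, c} \<notin> E" "{b, d} \<notin> E"
    using assms(2) unfolding has_2K2_def by blast
  have inj: "inj_on g S" and im: "g ` S = T"
    and eq: "\<And>x y. x \<in> S \<Longrightarrow> y \<in> S \<Longrightarrow> {x, y} \<in> E \<longleftrightarrow> {g x, g y} \<in> F"
    using assms(1) by (auto simp: iso_between_def bij_betw_def)
  have "g a \<noteq> g b" "g c \<noteq> g d" "{g a, g b} \<inter> {g c, g d} = {}"
    using ne S inj by (auto dest: inj_onD)
  moreover have "{g a, g b} \<in> F" "{g c, g d} \<in> F" "{g a, g c} \<notin> F" "{g a, g d} \<notin> F" "{g b, g c} \<notin> F" "{g b, g d} \<notin> F"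
    using e eq S by simp_all
  moreover have "g a \<in> T" "g b \<in> T" "g c \<in> T" "g d \<in> T" using S im by auto
  ultimately show ?thesis unfolding has_2K2_def by blast
qed

text \<open>An induced \<open>2K2\<close> occupies exactly four vertices, so it is visible on a
  single card, and the number of such cards agrees.\<close>

lemma deck_4_2K2:
  assumes fin: "finite V" "finite W" and deck: "deck 4 V E = deck 4 W F" and H: "has_2K2 F W"
  shows "has_2K2 E V"
proof (rule ccontr)
  assume no: "\<not> has_2K2 E V"
  obtain a b c d where W: "a \<in> W" "b \<in> W" "c \<in> W" "d \<in> W"
    and ne: "a \<noteq> b" "c \<noteq> d" "{a, b} \<inter> {c, d} = {}"
    and e: "{a, b} \<in> F" "{c, d} \<in> F" "{a, c} \<notin> F" "{a, d} \<notin> F" "{b, c} \<notin> F" "{b, d} \<notin> F"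
    using H unfolding has_2K2_def by blast
  have T: "{a, b, c, d} \<in> ksets W 4" using W ne by (auto simp: ksets_def)
  have K: "has_2K2 F {a, b, c, d}" unfolding has_2K2_def using ne e by blast
  have "(\<Sum>S\<in>ksets V 4. if has_2K2 E S then 1 else 0 :: nat) = (\<Sum>S\<in>ksets W 4. if has_2K2 F S then 1 else 0)"
  proof (rule deck_sum_eq[OF fin deck])
    fix S T g assume "iso_between g E S F T"
    then show "(if has_2K2 E S then 1 else 0 :: nat) = (if has_2K2 F T then 1 else 0)"
      using has_2K2_iso[of g E S F T] has_2K2_iso[OF iso_between_sym, of g E S F T] by auto
  qed
  moreover have "\<not> has_2K2 E S" if "S \<in> ksets V 4" for S
  proof
    assume "has_2K2 E S"
    moreover have "S \<subseteq> V" using that by (simp add: ksets_def)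
    ultimately have "has_2K2 E V" unfolding has_2K2_def by (meson subsetD)
    then show False using no by simp
  qed
  then have "(\<Sum>S\<in>ksets V 4. if has_2K2 E S then 1 else 0 :: nat) = 0" by simp
  ultimately have "(\<Sum>S\<in>ksets W 4. if has_2K2 F S then 1 else 0 :: nat) = 0" by simp
  then show False using T K finite_ksets[OF fin(2)] by (simp split: if_splits)
qed

lemma deg_set_disjoint: "i \<noteq> j \<Longrightarrow> deg_set E V i \<inter> deg_set E V j = {}"
  by (auto simp: deg_set_def)

text \<open>Take three vertices \<open>Q\<close> of degree 4, three leaves \<open>L\<close> and the
  remaining vertex \<open>p\<close>. Each vertex of \<open>Q\<close> has at most 2 neighbours in
  \<open>Q\<close>, so at least 6 edges leave \<open>Q\<close>; each leaf receives at most 1 of them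
  and \<open>p\<close> at most 3. Equality holds throughout: \<open>Q\<close> and \<open>p\<close>
  form a \<open>K4\<close>, and every leaf hangs on \<open>Q\<close>.\<close>

lemma seven_vertices_structure:
  assumes fin: "finite V" and V: "card V = 7"
    and d1: "3 \<le> card (deg_set E V 1)" and d4: "3 \<le> card (deg_set E V 4)"
  obtains Q p L where "V = insert p Q \<union> L" "card Q = 3" "card L = 3" "p \<notin> Q" "p \<notin> L"
    "Q \<subseteq> deg_set E V 4" "L \<subseteq> deg_set E V 1" "touch E V {p} = Q"
    "\<And>x y. x \<in> insert p Q \<Longrightarrow> y \<in> insert p Q \<Longrightarrow> x \<noteq> y \<Longrightarrow> {x, y} \<in> E"
    "\<And>l. l \<in> L \<Longrightarrow> touch E V {l} \<subseteq> Q"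
proof -
  let ?N = "\<lambda>v. touch E V {v}"
  have fN: "finite (?N v)" for v using fin touch_subset[of E V "{v}"] finite_subset by blast
  obtain Q where Q: "Q \<subseteq> deg_set E V 4" "card Q = 3" "finite Q" using d4 by (meson obtain_subset_with_card_n)
  obtain L where L: "L \<subseteq> deg_set E V 1" "card L = 3" "finite L" using d1 by (meson obtain_subset_with_card_n)
  have QV: "Q \<subseteq> V" and LV: "L \<subseteq> V" using Q L by (auto simp: deg_set_def)
  have QL: "Q \<inter> L = {}" using Q L deg_set_disjoint[of 4 1 E V] by auto
  have "card (Q \<union> L) = 6" using Q L QL by (simp add: card_Un_disjoint)
  then have "card (V - (Q \<union> L)) = 1" using QV LV Q L V by (simp add: card_Diff_subset)
  then obtain p where p: "V - (Q \<union> L) = {p}" using card_1_singletonE by blast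
  have pV: "p \<in> V" "p \<notin> Q" "p \<notin> L" using p by auto
  have VQ: "V - Q = insert p L" using p QL LV by auto
  \<comment> \<open>The edges between \<open>Q\<close> and the rest, counted from either
    end.\<close>
  have swap: "(\<Sum>q\<in>Q. card (?N q \<inter> (V - Q))) = (\<Sum>x\<in>V - Q. card (?N x \<inter> Q))"
  proof -
    have "(\<Sum>q\<in>Q. card (?N q \<inter> (V - Q))) = (\<Sum>q\<in>Q. \<Sum>x | x \<in> V - Q \<and> x \<in> ?N q. 1)"
      by (intro sum.cong refl) (simp add: Int_def conj_commute)
    also have "\<dots> = (\<Sum>x\<in>V - Q. \<Sum>q | q \<in> Q \<and> x \<in> ?N q. 1)"
      using Q fin by (intro sum.swap_restrict) auto
    also have "\<dots> = (\<Sum>x\<in>V - Q. card (?N x \<inter> Q))"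
    proof (intro sum.cong refl)
      fix x assume "x \<in> V - Q"
      then have "{q. q \<in> Q \<and> x \<in> ?N q} = ?N x \<inter> Q" using QV touch_vertex_sym[of x V _ E] by blast
      then show "(\<Sum>q | q \<in> Q \<and> x \<in> ?N q. 1) = card (?N x \<inter> Q)" by simp
    qed
    finally show ?thesis .
  qed
  have q4: "card (?N q \<inter> Q) + card (?N q \<inter> (V - Q)) = 4" "card (?N q \<inter> Q) \<le> 2" if q: "q \<in> Q" for q
  proof -
    have "?N q = (?N q \<inter> Q) \<union> (?N q \<inter> (V - Q))" using touch_subset[of E V "{q}"] by blast
    moreover have "card ((?N q \<inter> Q) \<union> (?N q \<inter> (V - Q))) = card (?N q \<inter> Q) + card (?N q \<inter> (V - Q))"
      using fN by (intro card_Un_disjoint) auto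
    ultimately show "card (?N q \<inter> Q) + card (?N q \<inter> (V - Q)) = 4" using Q q by (auto simp: deg_set_def)
    have "card (?N q \<inter> Q) \<le> card (Q - {q})"
      using Q touch_subset[of E V "{q}"] by (intro card_mono) auto
    then show "card (?N q \<inter> Q) \<le> 2" using Q q by simp
  qed
  have l1: "card (?N l \<inter> Q) \<le> 1" if "l \<in> L" for l
    using card_mono[OF fN, of "?N l \<inter> Q" l] L that by (auto simp: deg_set_def)
  have lhs: "(\<Sum>q\<in>Q. card (?N q \<inter> (V - Q))) \<ge> 6"
  proof -
    have "(\<Sum>q\<in>Q. 2) \<le> (\<Sum>q\<in>Q. card (?N q \<inter> (V - Q)))" by (intro sum_mono) (use q4 in fastforce)
    then show ?thesis using Q by simp
  qed
  have rhs: "(\<Sum>x\<in>V - Q. card (?N x \<inter> Q)) = card (?N p \<inter> Q) + (\<Sum>l\<in>L. card (?N l \<inter> Q))"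
    unfolding VQ using pV L by simp
  have rl: "(\<Sum>l\<in>L. card (?N l \<inter> Q)) \<le> 3"
    using sum_mono[of L "\<lambda>l. card (?N l \<inter> Q)" "\<lambda>_. 1"] l1 L by simp
  have pQ3: "card (?N p \<inter> Q) \<le> 3" using card_mono[of Q "?N p \<inter> Q"] Q by simp
  \<comment> \<open>Lower and upper bound are both 6, so each individual estimate must be
    sharp.\<close>
  have eqp: "card (?N p \<inter> Q) = 3" and eql: "(\<Sum>l\<in>L. card (?N l \<inter> Q)) = 3"
    and eqq: "(\<Sum>q\<in>Q. card (?N q \<inter> (V - Q))) = 6"
    using lhs rhs rl pQ3 swap by linarith+
  have "?N p \<inter> Q = Q" using card_subset_eq[of Q "?N p \<inter> Q"] Q eqp by simp
  then have Qp: "Q \<subseteq> ?N p" by blast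
  have lQ: "?N l \<subseteq> Q" if l: "l \<in> L" for l
  proof -
    have "card (?N l \<inter> Q) = 1"
    proof (rule ccontr)
      assume "card (?N l \<inter> Q) \<noteq> 1"
      then have "card (?N l \<inter> Q) < 1" using l1[OF l] by simp
      then have "(\<Sum>l\<in>L. card (?N l \<inter> Q)) < (\<Sum>l\<in>L. 1)"
        using l1 l L by (intro sum_strict_mono_ex1) auto
      then show False using eql L by simp
    qed
    moreover have "card (?N l) = 1" using l L by (auto simp: deg_set_def)
    ultimately have "?N l \<inter> Q = ?N l" using card_subset_eq[OF fN, of "?N l \<inter> Q" l] by simp
    then show ?thesis by blast
  qed
  have qQ: "?N q \<inter> Q = Q - {q}" if q: "q \<in> Q" for q
  proof -
    have "card (?N q \<inter> (V - Q)) = 2"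
    proof (rule ccontr)
      assume "card (?N q \<inter> (V - Q)) \<noteq> 2"
      then have "2 < card (?N q \<inter> (V - Q))" using q4[OF q] by linarith
      then have "(\<Sum>q\<in>Q. 2) < (\<Sum>q\<in>Q. card (?N q \<inter> (V - Q)))"
        using q Q q4 by (intro sum_strict_mono_ex1) fastforce+
      then show False using eqq Q by simp
    qed
    then have "card (?N q \<inter> Q) = 2" using q4[OF q] by simp
    moreover have "?N q \<inter> Q \<subseteq> Q - {q}" using touch_subset[of E V "{q}"] by blast
    ultimately show ?thesis using Q q by (intro card_subset_eq) auto
  qed
  have adj: "{x, y} \<in> E" if "y \<in> ?N x" for x y using that by (auto simp: touch_def)
  have cl: "{x, y} \<in> E" if xy: "x \<in> insert p Q" "y \<in> insert p Q" "x \<noteq> y" for x y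
  proof -
    consider "x = p" "y \<in> Q" | "x \<in> Q" "y = p" | "x \<in> Q" "y \<in> Q" using xy by blast
    then show ?thesis
    proof cases
      case 1
      then show ?thesis using adj Qp by blast
    next
      case 2
      then have "{y, x} \<in> E" using adj Qp by blast
      then show ?thesis by (simp add: insert_commute)
    next
      case 3
      then have "y \<in> ?N x" using qQ[of x] xy(3) by blast
      then show ?thesis using adj by blast
    qed
  qed
  \<comment> \<open>A leaf adjacent to \<open>p\<close> would have its only neighbour outside
    \<open>Q\<close>.\<close>
  have "?N p \<subseteq> Q"
  proof
    fix x assume x: "x \<in> ?N p"
    then have xV: "x \<in> V" "x \<noteq> p" by (auto simp: touch_def)
    have "x \<notin> L"
    proof
      assume "x \<in> L"
      moreover have "p \<in> ?N x" using touch_vertex_sym x xV pV by metis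
      ultimately show False using lQ pV by blast
    qed
    then show "x \<in> Q" using xV VQ by blast
  qed
  then have Np: "?N p = Q" using Qp by blast
  have "V = insert p Q \<union> L" using VQ QV LV pV by blast
  then show thesis using that[of p Q L] Q L pV Np cl lQ by blast
qed

text \<open>The surviving degree counts force the connected graph to be a \<open>K4\<close> with
  three leaves, which has no induced \<open>2K2\<close>. The other graph must contain a
  \<open>K4\<close> as well, and its degrees then produce an induced \<open>2K2\<close>.\<close>

lemma no_isolated_vertex_7:
  assumes fin: "finite V" "finite W" and card: "card V = 7" "card W = 7"
    and deck: "deck 4 V E = deck 4 W F"
    and G: "deg_set E V 0 = {}"
    and v: "v \<in> W" "touch F W {v} = {}"
  shows False
proof -
  note deg = no_isolated_vertex_7_degrees[OF fin card deck G v]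
  obtain Q p L where V: "V = insert p Q \<union> L" and Q: "card Q = 3" "Q \<subseteq> deg_set E V 4"
    and L: "card L = 3" "L \<subseteq> deg_set E V 1" and p: "p \<notin> Q" "p \<notin> L" "touch E V {p} = Q"
    and cl: "\<And>x y. x \<in> insert p Q \<Longrightarrow> y \<in> insert p Q \<Longrightarrow> x \<noteq> y \<Longrightarrow> {x, y} \<in> E"
    and leaf: "\<And>l. l \<in> L \<Longrightarrow> touch E V {l} \<subseteq> Q"
    using seven_vertices_structure[OF fin(1) card(1), of E] deg by (metis le_add2)
  have fQ: "finite Q" "finite L" using Q L card.infinite by fastforce+
  have "insert p Q \<in> cliques E V 4" using cl V Q p fQ by (auto simp: cliques_def ksets_def)
  moreover have "card (cliques E V 4) = card (cliques F W 4)"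
    using clique_profile_eq[OF fin _ deck, of 4 0 0] card by simp
  ultimately have "cliques F W 4 \<noteq> {}"
    using finite_cliques[OF fin(1), of E 4] by (metis card.empty card_0_eq empty_iff)
  then obtain Y where Y: "Y \<in> cliques F W 4" by blast
  \<comment> \<open>Every edge has an end in the \<open>K4\<close>, so two disjoint edges are always
    joined by an edge of the \<open>K4\<close>.\<close>
  have no: "\<not> has_2K2 E V"
  proof
    assume "has_2K2 E V"
    then obtain a b c d where S: "a \<in> V" "b \<in> V" "c \<in> V" "d \<in> V"
      and ne: "a \<noteq> b" "c \<noteq> d" "{a, b} \<inter> {c, d} = {}"
      and e: "{a, b} \<in> E" "{c, d} \<in> E" "{a, c} \<notin> E" "{a, d} \<notin> E" "{b, c} \<notin> E" "{b, d} \<notin> E"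
      unfolding has_2K2_def by blast
    have core: "x \<in> insert p Q \<or> y \<in> insert p Q" if "x \<in> V" "y \<in> V" "x \<noteq> y" "{x, y} \<in> E" for x y
    proof (cases "x \<in> L")
      case True
      have "y \<in> touch E V {x}" using that by (simp add: touch_def)
      then show ?thesis using leaf[OF True] by blast
    next
      case False
      then show ?thesis using V that by blast
    qed
    have "a \<in> insert p Q \<or> b \<in> insert p Q" "c \<in> insert p Q \<or> d \<in> insert p Q"
      using core S ne e by blast+
    then show False using cl ne e by blast
  qed
  have p3: "p \<in> deg_set E V 3" using V p Q by (simp add: deg_set_def)
  have "deg_set E V 2 = {}" "deg_set E V 3 = {p}" "deg_set E V 4 = Q" "deg_set E V 1 = L" "deg_set E V 5 = {}"
  proof -
    have val: "card (touch E V {x}) = (if x = p then 3 else if x \<in> Q then 4 else 1)" if "x \<in> V" for x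
      using that V p3 Q L by (auto simp: deg_set_def)
    have dQL: "Q \<inter> L = {}" using Q(2) L(2) deg_set_disjoint[of 4 1 E V] by auto
    show "deg_set E V 2 = {}" "deg_set E V 5 = {}" using val by (auto simp: deg_set_def)
    show "deg_set E V 3 = {p}" using val p3 by (auto simp: deg_set_def split: if_splits)
    show "deg_set E V 4 = Q" using val Q(2) by (auto simp: deg_set_def split: if_splits)
    show "deg_set E V 1 = L" using val L(2) V by (auto simp: deg_set_def split: if_splits)
  qed
  \<comment> \<open>The connected graph has degrees 1, 1, 1, 3, 4, 4, 4, hence the other one has 0,
    2, 2, 3, 3, 3, 5.\<close>
  then have b: "card (deg_set F W 0) = 1" "card (deg_set F W 1) = 0" "card (deg_set F W 2) = 2"
    "card (deg_set F W 3) = 3" "card (deg_set F W 4) = 0" "card (deg_set F W 5) = 1"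
    using deg Q L by auto
  have fD: "finite (deg_set F W i)" for i using fin(2) by (rule finite_deg_set)
  have D: "deg_set F W 1 = {}" "deg_set F W 4 = {}" using b fD by auto
  have D6: "deg_set F W 6 = {}" using deg_set_full_empty[OF fin(2) v] card by simp
  have "v \<in> deg_set F W 0" using v by (simp add: deg_set_def)
  then have D0: "deg_set F W 0 = {v}" using b(1) by (metis card_1_singletonE singletonD)
  have Y2: "Y \<subseteq> W" "card Y = 4" "\<And>x y. x \<in> Y \<Longrightarrow> y \<in> Y \<Longrightarrow> x \<noteq> y \<Longrightarrow> {x, y} \<in> F"
    using Y by (auto simp: cliques_def ksets_def)
  have fY: "finite Y" using Y2 fin(2) finite_subset by blast
  have Yt: "Y - {y} \<subseteq> touch F W {y}" if "y \<in> Y" for y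
    using Y2 that by (auto simp: touch_def)
  have fT: "finite (touch F W {y})" for y using fin(2) touch_subset[of F W "{y}"] finite_subset by blast
  have Ydeg: "3 \<le> card (touch F W {y})" if "y \<in> Y" for y
    using card_mono[OF fT Yt[OF that]] fY that Y2 by simp
  have "Y \<subseteq> deg_set F W 3 \<union> deg_set F W 5"
  proof
    fix y assume y: "y \<in> Y"
    then have "y \<in> W" using Y2 by blast
    moreover have "card (touch F W {y}) < 7" using card_touch_vertex_less[OF fin(2) calculation] card by simp
    moreover have "card (touch F W {y}) \<noteq> 4" "card (touch F W {y}) \<noteq> 6"
      using D D6 calculation(1) by (auto simp: deg_set_def)
    ultimately have "card (touch F W {y}) = 3 \<or> card (touch F W {y}) = 5" using Ydeg[OF y] by linarith
    then show "y \<in> deg_set F W 3 \<union> deg_set F W 5" using \<open>y \<in> W\<close> by (auto simp: deg_set_def)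
  qed
  \<comment> \<open>Vertices of a \<open>K4\<close> have degree at least 3, and exactly four
    vertices do, so the \<open>K4\<close> is determined.\<close>
  moreover have "card (deg_set F W 3 \<union> deg_set F W 5) = 4"
    using b fD deg_set_disjoint[of 3 5 F W] by (simp add: card_Un_disjoint)
  ultimately have YD: "Y = deg_set F W 3 \<union> deg_set F W 5" using Y2 fD by (intro card_subset_eq) auto
  obtain w where w: "deg_set F W 5 = {w}" using b(6) card_1_singletonE by blast
  \<comment> \<open>A vertex of degree 3 in the \<open>K4\<close> has all its neighbours there, so
    the vertices \<open>a\<close> and \<open>c\<close> of degree 2 cannot be adjacent to it.\<close>
  have N3: "touch F W {x} = Y - {x}" if "x \<in> deg_set F W 3" for x
  proof -
    have "x \<in> Y" using that YD by blast
    moreover have "card (touch F W {x}) = 3" using that by (simp add: deg_set_def)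
    ultimately show ?thesis using card_subset_eq[OF fT Yt, of x] fY Y2 by simp
  qed
  obtain a c where ac: "deg_set F W 2 = {a, c}" "a \<noteq> c" using b(3) by (meson card_2_iff)
  obtain x y z where xyz: "deg_set F W 3 = {x, y, z}" "x \<noteq> y" using b(4) by (auto simp: card_3_iff)
  have inW: "a \<in> W" "c \<in> W" "x \<in> W" "y \<in> W" using ac xyz by (auto simp: deg_set_def)
  have aY: "a \<notin> Y" "c \<notin> Y" using ac YD deg_set_disjoint[of 2 3 F W] deg_set_disjoint[of 2 5 F W] by auto
  have nadj: "u \<notin> touch F W {s}" if "u \<in> {a, c}" "s \<in> deg_set F W 3" for u s
    using N3[OF that(2)] aY that(1) by auto
  have nadj': "{u, s} \<notin> F" if "u \<in> {a, c}" "s \<in> {x, y}" for u s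
  proof
    assume e: "{u, s} \<in> F"
    have s3: "s \<in> deg_set F W 3" using that xyz by auto
    have "u \<noteq> s" using that aY YD s3 by blast
    then have "u \<in> touch F W {s}" using e that inW by (auto simp: touch_def insert_commute)
    then show False using nadj that(1) s3 by blast
  qed
  have "touch F W {a} \<subseteq> {w, c}"
  proof
    fix u assume u: "u \<in> touch F W {a}"
    then have uW: "u \<in> W" "u \<noteq> a" by (auto simp: touch_def)
    then have au: "a \<in> touch F W {u}" using u inW touch_vertex_sym by metis
    have "u \<notin> deg_set F W 3" using nadj[of a u] au by blast
    moreover have "u \<noteq> v" using au v by auto
    then have "u \<notin> deg_set F W 0" using D0 by simp
    moreover have "card (touch F W {u}) < 7" using card_touch_vertex_less[OF fin(2) uW(1)] card by simp
    ultimately have "card (touch F W {u}) \<in> {1, 2, 4, 5, 6}" using uW by (auto simp: deg_set_def)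
    moreover have "card (touch F W {u}) \<notin> {1, 4, 6}" using D D6 uW by (auto simp: deg_set_def)
    ultimately have "u \<in> deg_set F W 2 \<union> deg_set F W 5" using uW by (auto simp: deg_set_def)
    then show "u \<in> {w, c}" using ac w uW by auto
  qed
  moreover have "card (touch F W {a}) = 2" using ac by (auto simp: deg_set_def)
  \<comment> \<open>\<open>a\<close> needs two neighbours and only \<open>w\<close> and
    \<open>c\<close> are left. The edge \<open>{a, c}\<close> and an edge between two vertices of
    degree 3 now form the induced \<open>2K2\<close>.\<close>
  ultimately have "c \<in> touch F W {a}" using card_mono[of "{w}" "touch F W {a}"] by fastforce
  then have "{a, c} \<in> F" by (auto simp: touch_def)
  moreover have "{x, y} \<in> F" using Y2(3)[of x y] YD xyz by blast
  moreover have "{a, c} \<inter> {x, y} = {}" using aY YD xyz by auto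
  moreover have "{a, x} \<notin> F" "{a, y} \<notin> F" "{c, x} \<notin> F" "{c, y} \<notin> F" using nadj' by auto
  ultimately have "has_2K2 F W" unfolding has_2K2_def using inW ac(2) xyz(2) by blast
  then show False using deck_4_2K2[OF fin deck] no by blast
qed

lemma no_isolated_vertex:
  assumes fin: "finite V" "finite W" and card: "card V = card W" and n: "7 \<le> card V"
    and deck: "deck (card V - 3) V E = deck (card V - 3) W F"
    and con: "conn E V" and v: "v \<in> W" "touch F W {v} = {}"
  shows False
proof -
  have G: "touch E V {x} \<noteq> {}" if x: "x \<in> V" for x
  proof (rule conn_touch_nonempty[OF con])
    show "{x} \<noteq> V" using n by auto
  qed (use x in auto)
  then have G0: "deg_set E V 0 = {}"
  proof -
    have "finite (touch E V {x})" for x using fin(1) touch_subset[of E V "{x}"] finite_subset by blast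
    then show ?thesis using G by (auto simp: deg_set_def)
  qed
  consider "card V = 7" | "card V = 8" | "9 \<le> card V" using n by linarith
  then show False
  proof cases
    case 1
    then show False using no_isolated_vertex_7[OF fin _ _ _ G0 v] card deck by simp
  next
    case 2
    then show False using no_isolated_vertex_8[OF fin _ _ _ G0 v] card deck by simp
  next
    case 3
    have "X \<in> cliques E V 1 \<Longrightarrow> touch E V X \<noteq> {}" for X using G unfolding cliques_1 by blast
    moreover have "{v} \<in> cliques F W 1" using v unfolding cliques_1 by blast
    ultimately show False using no_isolated_vertex_ge_9[OF fin card 3 deck] v by blast
  qed
qed

section \<open>Transfer of connectedness\<close>

text \<open>Were the second graph disconnected, one of its connected cards would lie on one side of
  a cut, leaving a union \<open>B\<close> of components with at most 3 vertices on the other. Three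
  vertices leave room for only one connected card, and the smaller sizes give an isolated vertex or
  an isolated edge.\<close>

lemma conn_transfer:
  assumes fin: "finite V" "finite W" and card: "card V = card W" and n: "7 \<le> card V"
    and deck: "deck (card V - 3) V E = deck (card V - 3) W F" and con: "conn E V"
  shows "conn F W"
proof (rule ccontr)
  assume ncon: "\<not> conn F W"
  let ?k = "card V - 3"
  have two: "2 \<le> card (conn_sets F W ?k)"
    using two_conn_sets[OF con fin(1), of ?k] card_conn_sets_eq[OF fin deck] n by simp
  have "W \<noteq> {}" using card n by auto
  then obtain X where X: "X \<subseteq> W" "X \<noteq> {}" "X \<noteq> W" "\<And>x y. x \<in> X \<Longrightarrow> y \<in> W - X \<Longrightarrow> {x, y} \<notin> F"
    using ncon unfolding conn_def by blast
  have side: "S \<subseteq> X \<or> S \<subseteq> W - X" if S: "conn F S" "S \<subseteq> W" for S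
  proof (rule ccontr)
    assume "\<not> (S \<subseteq> X \<or> S \<subseteq> W - X)"
    then have "S \<inter> X \<subseteq> S" "S \<inter> X \<noteq> {}" "S \<inter> X \<noteq> S" using S by auto
    then obtain x y where "x \<in> S \<inter> X" "y \<in> S" "y \<notin> S \<inter> X" "{x, y} \<in> F" using connD[OF S(1)] by metis
    then show False using X(4) S(2) by blast
  qed
  have "conn_sets F W ?k \<noteq> {}" using two by force
  then obtain S0 where S0: "S0 \<subseteq> W" "card S0 = ?k" "conn F S0" by (auto simp: conn_sets_def ksets_def)
  \<comment> \<open>The side of the cut that avoids the connected card \<open>S0\<close>.\<close>
  define B where "B = (if S0 \<subseteq> X then W - X else X)"
  have B: "B \<subseteq> W" "B \<noteq> {}" "S0 \<subseteq> W - B"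
    using X side[OF S0(3,1)] S0(1) by (auto simp: B_def)
  have cross: "{x, y} \<notin> F" if "x \<in> B" "y \<in> W - B" for x y
    using that X(1) X(4)[of x y] X(4)[of y x] by (auto simp: B_def insert_commute split: if_splits)
  have sideB: "S \<subseteq> B \<or> S \<subseteq> W - B" if "conn F S" "S \<subseteq> W" for S
    using side[OF that] X(1) by (auto simp: B_def)
  have tB: "touch F W B = {}" using cross by (auto simp: touch_def)
  have fB: "finite B" using B fin(2) finite_subset by blast
  have cA: "card (W - B) = card V - card B" using B fB card by (simp add: card_Diff_subset)
  have "?k \<le> card (W - B)" using card_mono[of "W - B" S0] B fin(2) S0 by simp
  moreover have "card B \<le> card V" using card_mono[OF fin(2) B(1)] card by simp
  ultimately have cB: "card B \<le> 3" using cA n by linarith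
  \<comment> \<open>A card has at least 4 vertices and \<open>B\<close> at most 3, so every
    connected card lies in the other side.\<close>
  have sub: "conn_sets F W ?k \<subseteq> ksets (W - B) ?k"
  proof
    fix S assume S: "S \<in> conn_sets F W ?k"
    then have S': "conn F S" "S \<subseteq> W" "card S = ?k" by (auto simp: conn_sets_def ksets_def)
    have "\<not> S \<subseteq> B" using card_mono[OF fB, of S] S' cB n by auto
    then show "S \<in> ksets (W - B) ?k" using sideB S' by (auto simp: ksets_def)
  qed
  have fA: "finite (W - B)" using fin(2) by simp
  have le: "card (conn_sets F W ?k) \<le> (card V - card B) choose ?k"
    using card_mono[OF finite_ksets[OF fA] sub] n_subsets[OF fA, of ?k] cA by (simp add: ksets_def)
  have "card B \<noteq> 0" using B fB by simp
  then consider "card B = 1" | "card B = 2" | "card B = 3" using cB by linarith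
  then show False
  proof cases
    case 1
    then obtain v where "B = {v}" using card_1_singletonE by blast
    then show False using no_isolated_vertex[OF fin card n deck con, of v] B tB by simp
  next
    case 2
    then obtain u v where uv: "B = {u, v}" "u \<noteq> v" by (meson card_2_iff)
    show False
    proof (cases "{u, v} \<in> F")
      case True
      have "B \<in> cliques F W 2" using B 2 uv True by (auto simp: cliques_def ksets_def insert_commute)
      \<comment> \<open>This is the bound on the number of connected cards that
        \<open>no_isolated_edge\<close> requires.\<close>
      moreover have "(card V - 2) choose ?k = card V - 2"
      proof -
        have "card V - 2 = Suc ?k" using n by simp
        then show ?thesis by simp
      qed
      ultimately show False using no_isolated_edge[OF fin card n deck con _ tB] le 2 by simp
    next
      case False
      have "touch F W {u} = {}"
        using tB False uv by (auto simp: touch_def)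
      then show False using no_isolated_vertex[OF fin card n deck con, of u] B uv by simp
    qed
  next
    case 3
    then show False using le two by simp
  qed
qed

section \<open>Two graphs on six vertices\<close>

text \<open>Precompose the bijection with the inverse of \<open>g\<close>. Edges of size 2 are
  required so that every edge is of the form \<open>{x, y}\<close> to which the adjacency condition
  speaks. One inclusion suffices, since the other follows by exchanging the graphs.\<close>

lemma iso_imp_card_class_subset:
  assumes iso: "iso_between g E S F T"
    and E: "\<forall>e\<in>E. card e = 2" and F: "\<forall>e\<in>F. card e = 2"
  shows "card_class E S \<subseteq> card_class F T"
proof
  fix P assume "P \<in> card_class E S"
  then obtain f where f: "bij_betw f S {0..<card S}" "P = (\<lambda>e. f ` e) ` {e \<in> E. e \<subseteq> S}"
    unfolding card_class_def by blast
  have b: "bij_betw g S T" and e: "\<And>x y. x \<in> S \<Longrightarrow> y \<in> S \<Longrightarrow> {x, y} \<in> E \<longleftrightarrow> {g x, g y} \<in> F"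
    using iso by (auto simp: iso_between_def)
  have im: "g ` S = T" using b by (simp add: bij_betw_def)
  have cT: "card T = card S" using bij_betw_same_card[OF b] by simp
  define h where "h = f \<circ> inv_into S g"
  have "bij_betw h T {0..<card T}" unfolding h_def
    using bij_betw_trans[OF bij_betw_inv_into[OF b]] f(1) cT by simp
  moreover have hg: "h (g x) = f x" if "x \<in> S" for x
    unfolding h_def using that b by (simp add: bij_betw_def)
  have "P = (\<lambda>e. h ` e) ` {e \<in> F. e \<subseteq> T}"
  proof (rule set_eqI)
    fix p
    have "p \<in> P \<longleftrightarrow> (\<exists>x\<in>S. \<exists>y\<in>S. {x, y} \<in> E \<and> p = {f x, f y})"
    proof
      assume "p \<in> P"
      then obtain e where e': "e \<in> E" "e \<subseteq> S" "p = f ` e" using f(2) by blast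
      moreover obtain x y where "e = {x, y}" using E e'(1) by (meson card_2_iff)
      ultimately show "\<exists>x\<in>S. \<exists>y\<in>S. {x, y} \<in> E \<and> p = {f x, f y}" by auto
    next
      assume "\<exists>x\<in>S. \<exists>y\<in>S. {x, y} \<in> E \<and> p = {f x, f y}"
      then obtain x y where "x \<in> S" "y \<in> S" "{x, y} \<in> E" "p = f ` {x, y}" by auto
      then show "p \<in> P" unfolding f(2) by blast
    qed
    also have "\<dots> \<longleftrightarrow> (\<exists>x\<in>S. \<exists>y\<in>S. {g x, g y} \<in> F \<and> p = {h (g x), h (g y)})" using e hg by auto
    also have "\<dots> \<longleftrightarrow> (\<exists>x\<in>T. \<exists>y\<in>T. {x, y} \<in> F \<and> p = {h x, h y})" unfolding im[symmetric] by blast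
    also have "\<dots> \<longleftrightarrow> p \<in> (\<lambda>e. h ` e) ` {e \<in> F. e \<subseteq> T}"
    proof
      assume "\<exists>x\<in>T. \<exists>y\<in>T. {x, y} \<in> F \<and> p = {h x, h y}"
      then obtain x y where "x \<in> T" "y \<in> T" "{x, y} \<in> F" "p = h ` {x, y}" by auto
      then show "p \<in> (\<lambda>e. h ` e) ` {e \<in> F. e \<subseteq> T}" by blast
    next
      assume "p \<in> (\<lambda>e. h ` e) ` {e \<in> F. e \<subseteq> T}"
      then obtain e where e': "e \<in> F" "e \<subseteq> T" "p = h ` e" by blast
      moreover obtain x y where "e = {x, y}" using F e'(1) by (meson card_2_iff)
      ultimately show "\<exists>x\<in>T. \<exists>y\<in>T. {x, y} \<in> F \<and> p = {h x, h y}" by auto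
    qed
    finally show "p \<in> P \<longleftrightarrow> p \<in> (\<lambda>e. h ` e) ` {e \<in> F. e \<subseteq> T}" .
  qed
  ultimately show "P \<in> card_class F T" unfolding card_class_def by blast
qed

section \<open>Three-vertex cards are determined by their number of edges\<close>

definition triple_edges :: "'a set set \<Rightarrow> 'a \<times> 'a \<times> 'a \<Rightarrow> nat" where
  "triple_edges E = (\<lambda>(a, b, c). of_bool ({a, b} \<in> E) + of_bool ({a, c} \<in> E) + of_bool ({b, c} \<in> E))"

definition triple_set :: "'a \<times> 'a \<times> 'a \<Rightarrow> 'a set" where
  "triple_set = (\<lambda>(a, b, c). {a, b, c})"

text \<open>A normal form for graphs on three vertices: they can be ordered so that the edges appear
  in the order \<open>{x, y}\<close>, \<open>{y, z}\<close>, \<open>{x, z}\<close>, whence the edge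
  number fixes the isomorphism type.\<close>

lemma triple_canonical:
  assumes "card {a, b, c} = 3"
  obtains x y z where "{a, b, c} = {x, y, z}" "x \<noteq> y" "x \<noteq> z" "y \<noteq> z"
    "{x, y} \<in> E \<longleftrightarrow> 1 \<le> triple_edges E (a, b, c)" "{y, z} \<in> E \<longleftrightarrow> 2 \<le> triple_edges E (a, b, c)"
    "{x, z} \<in> E \<longleftrightarrow> 3 \<le> triple_edges E (a, b, c)"
proof -
  have d: "a \<noteq> b" "a \<noteq> c" "b \<noteq> c" using assms by (auto simp: card_insert_if split: if_splits)
  have t: "triple_edges E (a, b, c) = of_bool ({a, b} \<in> E) + of_bool ({a, c} \<in> E) + of_bool ({b, c} \<in> E)"
    by (simp add: triple_edges_def)
  have s: "{b, a} = {a, b}" "{c, a} = {a, c}" "{c, b} = {b, c}" by auto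
  \<comment> \<open>The given order is already normal in the first case; the other three are
    repaired by the orders \<open>a c b\<close>, \<open>b c a\<close> and
    \<open>b a c\<close>.\<close>
  consider "{a, b} \<in> E \<longleftrightarrow> 1 \<le> triple_edges E (a, b, c)" "{b, c} \<in> E \<longleftrightarrow> 2 \<le> triple_edges E (a, b, c)"
      "{a, c} \<in> E \<longleftrightarrow> 3 \<le> triple_edges E (a, b, c)"
    | "{a, b} \<notin> E" "{a, c} \<in> E" | "{a, b} \<notin> E" "{a, c} \<notin> E" "{b, c} \<in> E"
    | "{a, b} \<in> E" "{a, c} \<in> E" "{b, c} \<notin> E"
    by (cases "{a, b} \<in> E"; cases "{a, c} \<in> E"; cases "{b, c} \<in> E") (simp_all add: t)
  then show thesis
  proof cases
    case 1
    show thesis by (rule that[of a b c]) (use 1 d in simp_all)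
  next
    case 2
    show thesis by (rule that[of a c b]) (use 2 d in \<open>auto simp: t s\<close>)
  next
    case 3
    show thesis by (rule that[of b c a]) (use 3 d in \<open>auto simp: t s\<close>)
  next
    case 4
    show thesis by (rule that[of b a c]) (use 4 d in \<open>auto simp: t s\<close>)
  qed
qed

lemma triple_card_class_subset:
  assumes E: "\<forall>e\<in>E. card e = 2" and F: "\<forall>e\<in>F. card e = 2"
    and s: "card (triple_set s) = 3" and t: "card (triple_set t) = 3"
    and eq: "triple_edges E s = triple_edges F t"
  shows "card_class E (triple_set s) \<subseteq> card_class F (triple_set t)"
proof -
  obtain a b c where abc: "s = (a, b, c)" by (cases s)
  obtain a' b' c' where abc': "t = (a', b', c')" by (cases t)
  obtain x y z where x: "{a, b, c} = {x, y, z}" "x \<noteq> y" "x \<noteq> z" "y \<noteq> z"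
    "{x, y} \<in> E \<longleftrightarrow> 1 \<le> triple_edges E s" "{y, z} \<in> E \<longleftrightarrow> 2 \<le> triple_edges E s"
    "{x, z} \<in> E \<longleftrightarrow> 3 \<le> triple_edges E s"
    using triple_canonical[of a b c E] s abc by (auto simp: triple_set_def)
  obtain u v w where u: "{a', b', c'} = {u, v, w}" "u \<noteq> v" "u \<noteq> w" "v \<noteq> w"
    "{u, v} \<in> F \<longleftrightarrow> 1 \<le> triple_edges F t" "{v, w} \<in> F \<longleftrightarrow> 2 \<le> triple_edges F t"
    "{u, w} \<in> F \<longleftrightarrow> 3 \<le> triple_edges F t"
    using triple_canonical[of a' b' c' F] t abc' by (auto simp: triple_set_def)
  define g where "g i = (if i = x then u else if i = y then v else w)" for i
  have g: "g x = u" "g y = v" "g z = w" using x by (auto simp: g_def)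
  have "bij_betw g {x, y, z} {u, v, w}" using g x u by (auto simp: bij_betw_def inj_on_def)
  \<comment> \<open>The adjacency condition of \<open>iso_between\<close> also ranges over equal
    arguments, where both sides must be false.\<close>
  moreover have "{i, i} \<notin> E" "{j, j} \<notin> F" for i j using E F by fastforce+
  then have "\<forall>i\<in>{x, y, z}. \<forall>j\<in>{x, y, z}. {i, j} \<in> E \<longleftrightarrow> {g i, g j} \<in> F"
    using g x u eq by (simp add: insert_commute)
  ultimately have "iso_between g E (triple_set s) F (triple_set t)"
    using x(1) u(1) abc abc' by (simp add: iso_between_def triple_set_def)
  then show ?thesis by (rule iso_imp_card_class_subset) (use E F in auto)
qed

definition path6 :: "nat set set" where
  "path6 = {{0, 1}, {1, 2}, {2, 3}, {3, 4}, {4, 5}}"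

definition cycle4_edge :: "nat set set" where
  "cycle4_edge = {{0, 1}, {1, 2}, {2, 3}, {0, 3}, {4, 5}}"

text \<open>The 20 three-element subsets listed as tuples, so that edge numbers can be computed by
  evaluation.\<close>

definition triples6 :: "(nat \<times> nat \<times> nat) list" where
  "triples6 = [(0,1,2), (0,1,3), (0,1,4), (0,1,5), (0,2,3), (0,2,4), (0,2,5), (0,3,4), (0,3,5), (0,4,5),
    (1,2,3), (1,2,4), (1,2,5), (1,3,4), (1,3,5), (1,4,5), (2,3,4), (2,3,5), (2,4,5), (3,4,5)]"

lemma distinct_triples6: "distinct (map triple_set triples6)"
  by code_simp

lemma ksets_triples6: "ksets {0..<6} 3 = set (map triple_set triples6)"
proof -
  have "set (map triple_set triples6) \<subseteq> ksets {0..<6} 3"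
    unfolding triples6_def triple_set_def by (simp add: ksets_def)
  moreover have "card (set (map triple_set triples6)) = 20"
    using distinct_card[OF distinct_triples6] by (simp add: triples6_def)
  moreover have "card (ksets {0..<6::nat} 3) = 20"
    using n_subsets[of "{0..<6::nat}" 3] by (simp add: ksets_def numeral_eq_Suc)
  ultimately show ?thesis
    using card_subset_eq[of "ksets {0..<6::nat} 3" "set (map triple_set triples6)"] finite_ksets by fastforce
qed

text \<open>Both graphs have five edges, no triangle and four vertices of degree 2. So each has 4
  triples with two edges, 12 with one edge and 4 with none.\<close>

lemma triple_edges_path6_cycle4_edge:
  "image_mset (triple_edges path6) (mset triples6) = image_mset (triple_edges cycle4_edge) (mset triples6)"
proof -
  have "sort (map (triple_edges path6) triples6) = sort (map (triple_edges cycle4_edge) triples6)" by code_simp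
  then have "mset (map (triple_edges path6) triples6) = mset (map (triple_edges cycle4_edge) triples6)"
    by (metis mset_sort)
  then show ?thesis by simp
qed

lemma deck_path6_cycle4_edge: "deck 3 {0..<6} path6 = deck 3 {0..<6} cycle4_edge"
proof -
  have E: "\<forall>e\<in>path6. card e = 2" and F: "\<forall>e\<in>cycle4_edge. card e = 2"
    by (auto simp: path6_def cycle4_edge_def)
  have m: "mset_set (ksets {0..<6} 3) = image_mset triple_set (mset triples6)"
    using mset_set_set[OF distinct_triples6] ksets_triples6 by simp
  have c3: "card (triple_set s) = 3" if "s \<in># mset triples6" for s
  proof -
    have "triple_set s \<in> ksets {0..<6} 3" using that ksets_triples6 by auto
    then show ?thesis by (simp add: ksets_def)
  qed
  have "image_mset (card_class path6 \<circ> triple_set) (mset triples6)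
      = image_mset (card_class cycle4_edge \<circ> triple_set) (mset triples6)"
  proof (rule image_mset_eq_transfer[OF triple_edges_path6_cycle4_edge])
    fix s t assume s: "s \<in># mset triples6" and t: "t \<in># mset triples6"
      and eq: "triple_edges path6 s = triple_edges cycle4_edge t"
    show "(card_class path6 \<circ> triple_set) s = (card_class cycle4_edge \<circ> triple_set) t"
      using triple_card_class_subset[OF E F c3[OF s] c3[OF t] eq]
        triple_card_class_subset[OF F E c3[OF t] c3[OF s] eq[symmetric]] by simp
  qed
  then show ?thesis using m by (simp add: deck_def ksets_def multiset.map_comp)
qed

lemma conn_path6: "conn path6 {0..<6}"
proof -
  have "conn path6 {0}" by (rule conn_singleton)
  then have "conn path6 {1, 0}" by (rule conn_insert[where x = 0]) (auto simp: path6_def)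
  then have "conn path6 {2, 1, 0}" by (rule conn_insert[where x = 1]) (auto simp: path6_def)
  then have "conn path6 {3, 2, 1, 0}" by (rule conn_insert[where x = 2]) (auto simp: path6_def)
  then have "conn path6 {4, 3, 2, 1, 0}" by (rule conn_insert[where x = 3]) (auto simp: path6_def)
  then have "conn path6 {5, 4, 3, 2, 1, 0}" by (rule conn_insert[where x = 4]) (auto simp: path6_def)
  moreover have "{5, 4, 3, 2, 1, 0} = {0..<6::nat}" by auto
  ultimately show ?thesis by simp
qed

lemma not_conn_cycle4_edge: "\<not> conn cycle4_edge {0..<6}"
proof
  assume c: "conn cycle4_edge {0..<6}"
  have "0 \<in> {0..<6::nat}" "0 \<notin> {4, 5::nat}" by simp_all
  then have "{4, 5} \<noteq> {0..<6::nat}" by blast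
  moreover have "{4, 5} \<subseteq> {0..<6::nat}" "{4, 5} \<noteq> ({} :: nat set)" by auto
  ultimately obtain x y where "x \<in> {4, 5::nat}" "y \<in> {0..<6::nat}" "y \<notin> {4, 5}" "{x, y} \<in> cycle4_edge"
    using connD[OF c] by metis
  then show False by (auto simp: cycle4_edge_def doubleton_eq_iff)
qed

theorem theorem1p5:
  shows "(\<forall>(n::nat) (V1::'a set) E1 (V2::'b set) E2.
            n \<ge> 7 \<longrightarrow> simple_graph V1 E1 \<longrightarrow> simple_graph V2 E2 \<longrightarrow>
            card V1 = n \<longrightarrow> card V2 = n \<longrightarrow>
            deck (n - 3) V1 E1 = deck (n - 3) V2 E2 \<longrightarrow>
            (connected_graph V1 E1 \<longleftrightarrow> connected_graph V2 E2))
       \<and> (\<exists>(V1::nat set) E1 (V2::nat set) E2.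
            simple_graph V1 E1 \<and> simple_graph V2 E2 \<and> card V1 = 6 \<and> card V2 = 6 \<and>
            deck 3 V1 E1 = deck 3 V2 E2 \<and>
            connected_graph V1 E1 \<and> \<not> connected_graph V2 E2)"
proof (intro conjI allI impI)
  fix n and V1 :: "'a set" and E1 and V2 :: "'b set" and E2
  assume n: "7 \<le> n" and s: "simple_graph V1 E1" "simple_graph V2 E2"
    and c: "card V1 = n" "card V2 = n" and deck: "deck (n - 3) V1 E1 = deck (n - 3) V2 E2"
  have fin: "finite V1" "finite V2" using s by (auto simp: simple_graph_def)
  show "connected_graph V1 E1 \<longleftrightarrow> connected_graph V2 E2"
    \<comment> \<open>The transfer lemma goes in one direction only and is applied with the roles of
      the graphs exchanged for the other.\<close>
    using conn_transfer[OF fin, of E1 E2] conn_transfer[OF fin(2,1), of E2 E1] n c deck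
    by (auto simp: connected_graph_iff_conn[OF s(1)] connected_graph_iff_conn[OF s(2)])
next
  have s: "simple_graph {0..<6} path6" "simple_graph {0..<6} cycle4_edge"
    by (auto simp: simple_graph_def path6_def cycle4_edge_def)
  then show "\<exists>(V1::nat set) E1 (V2::nat set) E2.
            simple_graph V1 E1 \<and> simple_graph V2 E2 \<and> card V1 = 6 \<and> card V2 = 6 \<and>
            deck 3 V1 E1 = deck 3 V2 E2 \<and>
            connected_graph V1 E1 \<and> \<not> connected_graph V2 E2"
    using deck_path6_cycle4_edge conn_path6 not_conn_cycle4_edge
      connected_graph_iff_conn[OF s(1)] connected_graph_iff_conn[OF s(2)]
    by (intro exI[of _ "{0..<6}"] exI[of _ path6] exI[of _ cycle4_edge]) simp
qed

end
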